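(* Let $\mathcal G:\mathscr P_2(\mathbb R^d)\to\mathbb R\cup\{+\infty\}$ be convex along plans and locally Lipschitz around $\mu\in\mathscr P_2(\mathbb R^d)$, and let $\Xi\in L^2_\mu$. Then $$\Xi\in\partial_C\mathcal G(\mu)\iff\forall\nu\in\mathscr P_2(\mathbb R^d),\ \forall\gamma\in\Gamma(\mu,\nu),\quad\mathcal G(\mu)+\int_{\mathbb R^{2d}}\langle\Xi(x),y-x\rangle\,d\gamma(x,y)\le\mathcal G(\nu).$$
   Context: $\mathscr P_2(\mathbb R^d)$ is the space of Borel probability measures on $\mathbb R^d$ with finite second moment, with the 2-Wasserstein distance; $\Gamma(\mu,\nu)$ is the set of all couplings; $L^2_\mu$ is the space of $\mu$-square-integrable maps $\mathbb R^d\to\mathbb R^d$ with inner product $\langle\cdot,\cdot\rangle_\mu$. Convex along plans: for all $\mu,\nu\in\mathscr P_2(\mathbb R^d)$, all $\gamma\in\Gamma(\mu,\nu)$ and all $t\in[0,1]$, $\mathcal G(((1-t)\pi^1+t\pi^2)_\#\gamma)\le(1-t)\mathcal G(\mu)+t\mathcal G(\nu)$. Locally Lipschitz around $\mu$: finite and Lipschitz in a neighborhood of $\mu$. Clarke subdifferential: let $C_1(\mathbb R^d;\mathbb R^d)$ be the set of continuous maps $w$ with $\sup_x|w(x)|/(1+|x|)<\infty$; $D\mathcal G(\mu)(w):=\limsup_{\nu\to\mu,\ t\searrow0}\frac{\mathcal G((\mathrm{id}+tw)_\#\nu)-\mathcal G(\nu)}{t}$ and $\partial_C\mathcal G(\mu):=\{\Xi\in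 L^2_\mu:\ \langle\Xi,w\rangle_\mu\le D\mathcal G(\mu)(w)\ \ \forall w\in C_1(\mathbb R^d;\mathbb R^d)\}$. *)

theory Defs
  imports "HOL-Probability.Probability"
begin

text \<open>The space \<open>R^d\<close> is rendered by a type \<open>'a\<close> of class \<open>euclidean_space\<close>, with
  \<open>d = DIM('a)\<close>. A functional on \<open>P2\<close> with values in the reals extended by \<open>+\<infinity>\<close> is a
  function \<open>'a measure \<Rightarrow> ereal\<close> that avoids \<open>-\<infinity>\<close> on \<open>P2\<close>; every notion below only
  looks at its values on \<open>P2\<close>.\<close>

definition P2 :: "'a::euclidean_space measure set" where
  "P2 = {\<mu>. prob_space \<mu> \<and> sets \<mu> = sets borel \<and> integrable \<mu> (\<lambda>x. (norm x)\<^sup>2)}"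

definition couplings ::
  "'a::euclidean_space measure \<Rightarrow> 'a measure \<Rightarrow> ('a \<times> 'a) measure set" where
  "couplings \<mu> \<nu> = {\<gamma>. prob_space \<gamma> \<and> sets \<gamma> = sets borel \<and>
     distr \<gamma> borel fst = \<mu> \<and> distr \<gamma> borel snd = \<nu>}"

text \<open>For \<open>\<mu>\<close> and \<open>\<nu>\<close> in \<open>P2\<close> the set of couplings is nonempty (it contains the product measure)
  and the cost is integrable under every coupling, so the real infimum of real integrals is the
  intended one.\<close>

definition W2 :: "'a::euclidean_space measure \<Rightarrow> 'a measure \<Rightarrow> real" where
  "W2 \<mu> \<nu> = sqrt (INF \<gamma>\<in>couplings \<mu> \<nu>. \<integral>p. (dist (fst p) (snd p))\<^sup>2 \<partial>\<gamma>)"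

text \<open>The neighbourhood filter of \<open>\<mu>\<close> in the metric space \<open>(P2, W2)\<close>; it is not punctured at
  \<open>\<mu>\<close>.\<close>

definition nhds_W2 :: "'a::euclidean_space measure \<Rightarrow> 'a measure filter" where
  "nhds_W2 \<mu> = (INF r\<in>{0<..}. principal {\<nu>\<in>P2. W2 \<mu> \<nu> < r})"

text \<open>Square-integrable maps are represented by functions, not by classes modulo \<open>\<mu>\<close>-null sets;
  all notions in which they occur are invariant under modification on a null set.\<close>

definition L2 :: "'a::euclidean_space measure \<Rightarrow> ('a \<Rightarrow> 'a) set" where
  "L2 \<mu> = {f \<in> borel_measurable \<mu>. integrable \<mu> (\<lambda>x. (norm (f x))\<^sup>2)}"

definition inner_L2 ::
  "'a::euclidean_space measure \<Rightarrow> ('a \<Rightarrow> 'a) \<Rightarrow> ('a \<Rightarrow> 'a) \<Rightarrow> real" where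
  "inner_L2 \<mu> f g = (\<integral>x. f x \<bullet> g x \<partial>\<mu>)"

text \<open>In \<open>ereal\<close> we have \<open>0 * \<infinity> = 0\<close>, so the inequality holds trivially at the end points
  \<open>t = 0\<close> and \<open>t = 1\<close>.\<close>

definition convex_along_plans :: "('a::euclidean_space measure \<Rightarrow> ereal) \<Rightarrow> bool" where
  "convex_along_plans G \<longleftrightarrow>
     (\<forall>\<mu>\<in>P2. \<forall>\<nu>\<in>P2. \<forall>\<gamma>\<in>couplings \<mu> \<nu>. \<forall>t\<in>{0..1::real}.
        G (distr \<gamma> borel (\<lambda>p. (1 - t) *\<^sub>R fst p + t *\<^sub>R snd p))
          \<le> ereal (1 - t) * G \<mu> + ereal t * G \<nu>)"

definition locally_Lipschitz_around ::
  "('a::euclidean_space measure \<Rightarrow> ereal) \<Rightarrow> 'a measure \<Rightarrow> bool" where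
  "locally_Lipschitz_around G \<mu> \<longleftrightarrow>
     (\<exists>r>0. \<exists>L\<ge>0.
        (\<forall>\<nu>\<in>P2. W2 \<mu> \<nu> < r \<longrightarrow> \<bar>G \<nu>\<bar> \<noteq> \<infinity>) \<and>
        (\<forall>\<nu>\<in>P2. \<forall>\<nu>'\<in>P2. W2 \<mu> \<nu> < r \<longrightarrow> W2 \<mu> \<nu>' < r \<longrightarrow>
           \<bar>G \<nu> - G \<nu>'\<bar> \<le> ereal (L * W2 \<nu> \<nu>')))"

definition C1 :: "('a::euclidean_space \<Rightarrow> 'a) set" where
  "C1 = {w. continuous_on UNIV w \<and> bdd_above (range (\<lambda>x. norm (w x) / (1 + norm x)))}"

text \<open>When \<open>G\<close> is locally Lipschitz around \<open>\<mu>\<close>, both values of \<open>G\<close> in the quotient are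
  eventually finite along the filter, so the value given to \<open>\<infinity> - \<infinity>\<close> is irrelevant.\<close>

definition clarke_deriv ::
  "('a::euclidean_space measure \<Rightarrow> ereal) \<Rightarrow> 'a measure \<Rightarrow> ('a \<Rightarrow> 'a) \<Rightarrow> ereal" where
  "clarke_deriv G \<mu> w =
     Limsup (nhds_W2 \<mu> \<times>\<^sub>F at_right (0::real))
       (\<lambda>(\<nu>, t). (G (distr \<nu> borel (\<lambda>x. x + t *\<^sub>R w x)) - G \<nu>) / ereal t)"

definition clarke_subdiff ::
  "('a::euclidean_space measure \<Rightarrow> ereal) \<Rightarrow> 'a measure \<Rightarrow> ('a \<Rightarrow> 'a) set" where
  "clarke_subdiff G \<mu> = {\<Xi> \<in> L2 \<mu>. \<forall>w\<in>C1. ereal (inner_L2 \<mu> \<Xi> w) \<le> clarke_deriv G \<mu> w}"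

end

theory Submission
  imports Defs
begin

text \<open>If the inequality holds for all couplings, testing it with \<open>(id, id + t w)\<close> bounds the difference
  quotients at \<open>\<mu>\<close> itself from below.

  Conversely, by convexity the difference quotients are monotone in \<open>t\<close>, so a Clarke subgradient
  satisfies \<open>G \<mu> + T \<langle>\<Xi>, w\<rangle> \<le> G ((id + T w)\<^sub># \<mu>)\<close> for all bounded Lipschitz \<open>w\<close> and all
  \<open>T > 0\<close>. To pass from maps to a coupling \<open>\<gamma>\<close>, partition the space into finitely many cells on
  which \<open>x\<close> and \<open>\<Xi> x\<close> are nearly constant, and replace, conditionally on the cell of \<open>x\<close>, the
  interpolant \<open>(1 - T) x + T y\<close> by the midpoint of two independent copies of itself. By convexity
  along plans this does not increase \<open>G\<close>, and it halves the conditional variances. In the limit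
  the interpolant becomes its cell average, which is \<open>L\<^sup>2\<close>-close to \<open>x + T w x\<close> for a bounded Lipschitz
  approximation \<open>w\<close> of the cell averages of \<open>y - x\<close>. The Lipschitz bound on \<open>G\<close> controls the
  errors for a fixed small \<open>T\<close>, and no disintegration of \<open>\<gamma>\<close> is needed.\<close>

subsection \<open>Square-integrable maps and couplings\<close>

text \<open>Maps see only the barycentric projection of \<gamma>, while the claim concerns \<gamma>
  itself. The gap is closed by a Jensen inequality: averaging the interpolant over a cell does not
  increase \<open>G\<close>. Convexity along plans is a two-point condition and does not yield this
  for continuous averages at once; hence dyadic averages, whose limit is taken inside the ball of
  radius \<open>r\<close> where \<open>G\<close> is Lipschitz. This is why the step \<open>T\<close>
  must be small. Cells resolve \<Xi> x so that the pairing of \<Xi> with y - x depends, up to a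
  small error, only on the cell means of y - x. They resolve x because averaging the interpolant
  also averages x. The Lipschitz bound on \<open>G\<close> costs an error of order \<epsilon>, not T
  \<epsilon>, so \<epsilon> tends to 0 with \<open>T\<close> fixed and \<open>T\<close> is cancelled
  only at the end. The test maps \<open>w\<close> are Lipschitz because the Clarke derivative moves
  the base point: at a fixed step the push-forward by id + T w has to be continuous for
  \<open>W2\<close>.\<close>

lemma norm_add_squared_le: "(norm (x + y))\<^sup>2 \<le> 2 * (norm x)\<^sup>2 + 2 * (norm y)\<^sup>2"
  for x y :: "'a::real_inner"
proof -
  have "0 \<le> (norm (x - y))\<^sup>2" by simp
  then show ?thesis by (simp add: power2_norm_eq_inner inner_simps inner_commute)
qed

text \<open>\<open>L2\<close> has one Euclidean space as source and target. Here the source is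
  arbitrary, since most maps live on a coupling \<gamma>, and the target varies: pairs (x, \<Xi> x)
  and real indicators also occur.\<close>

definition square_integrable :: "'b measure \<Rightarrow> ('b \<Rightarrow> 'a::euclidean_space) \<Rightarrow> bool" where
  "square_integrable M f \<longleftrightarrow> f \<in> borel_measurable M \<and> integrable M (\<lambda>x. (norm (f x))\<^sup>2)"

lemma square_integrableD:
  assumes "square_integrable M f"
  shows square_integrable_measurable[measurable_dest]: "f \<in> borel_measurable M"
    and "integrable M (\<lambda>x. (norm (f x))\<^sup>2)"
  using assms by (auto simp: square_integrable_def)

lemma square_integrable_bound:
  assumes "f \<in> borel_measurable M" "integrable M g" "\<And>x. x \<in> space M \<Longrightarrow> (norm (f x))\<^sup>2 \<le> g x"
  shows "square_integrable M f"
  unfolding square_integrable_def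
proof
  show "integrable M (\<lambda>x. (norm (f x))\<^sup>2)"
    by (rule Bochner_Integration.integrable_bound[OF assms(2)])
      (use assms in \<open>auto intro!: AE_I2 order_trans[OF _ abs_ge_self]\<close>)
qed fact

lemma square_integrable_add:
  assumes "square_integrable M f" "square_integrable M g"
  shows "square_integrable M (\<lambda>x. f x + g x)"
  using square_integrableD[OF assms(1)] square_integrableD[OF assms(2)]
  by (intro square_integrable_bound[where g="\<lambda>x. 2 * (norm (f x))\<^sup>2 + 2 * (norm (g x))\<^sup>2"])
    (auto intro: norm_add_squared_le)

lemma square_integrable_scaleR:
  assumes "square_integrable M f"
  shows "square_integrable M (\<lambda>x. c *\<^sub>R f x)"
  using assms by (auto simp: square_integrable_def power_mult_distrib)

lemma square_integrable_diff:
  assumes "square_integrable M f" "square_integrable M g"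
  shows "square_integrable M (\<lambda>x. f x - g x)"
  using square_integrable_add[OF assms(1) square_integrable_scaleR[OF assms(2), of "-1"]] by simp

lemma (in finite_measure) square_integrable_bounded:
  assumes "f \<in> borel_measurable M" "\<And>x. x \<in> space M \<Longrightarrow> norm (f x) \<le> B"
  shows "square_integrable M f"
  using assms by (intro square_integrable_bound[where g="\<lambda>_. B\<^sup>2"]) (auto intro: power_mono)

lemma square_integrable_inner:
  assumes "square_integrable M f" "square_integrable M g"
  shows "integrable M (\<lambda>x. f x \<bullet> g x)"
proof (rule Bochner_Integration.integrable_bound)
  show "integrable M (\<lambda>x. (norm (f x))\<^sup>2 + (norm (g x))\<^sup>2)"
    using assms by (simp add: square_integrable_def)
  show "(\<lambda>x. f x \<bullet> g x) \<in> borel_measurable M"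
    using assms by (auto simp: square_integrable_def)
  show "AE x in M. norm (f x \<bullet> g x) \<le> norm ((norm (f x))\<^sup>2 + (norm (g x))\<^sup>2)"
  proof (rule AE_I2)
    fix x
    have "\<bar>f x \<bullet> g x\<bar> \<le> norm (f x) * norm (g x)" by (rule Cauchy_Schwarz_ineq2)
    also have "\<dots> \<le> (norm (f x))\<^sup>2 + (norm (g x))\<^sup>2"
      using sum_squares_bound[of "norm (f x)" "norm (g x)"]
        mult_nonneg_nonneg[OF norm_ge_zero norm_ge_zero, of "f x" "g x"] by linarith
    finally show "norm (f x \<bullet> g x) \<le> norm ((norm (f x))\<^sup>2 + (norm (g x))\<^sup>2)" by simp
  qed
qed

lemma (in finite_measure) square_integrable_imp_integrable:
  assumes "square_integrable M f"
  shows "integrable M f"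
proof (rule Bochner_Integration.integrable_bound)
  show "integrable M (\<lambda>x. 1 + (norm (f x))\<^sup>2)"
    using assms by (simp add: square_integrable_def)
  show "AE x in M. norm (f x) \<le> norm (1 + (norm (f x))\<^sup>2)"
  proof (rule AE_I2)
    fix x
    show "norm (f x) \<le> norm (1 + (norm (f x))\<^sup>2)"
      using sum_squares_bound[of "norm (f x)" 1] norm_ge_zero[of "f x"] by (auto simp: abs_if)
  qed
qed (use assms in \<open>simp add: square_integrable_def\<close>)

lemma square_integrable_distr:
  assumes "g \<in> measurable M N" "f \<in> borel_measurable N"
  shows "square_integrable (distr M N g) f \<longleftrightarrow> square_integrable M (\<lambda>x. f (g x))"
  using assms by (auto simp: square_integrable_def integrable_distr_eq)

lemma integral_norm_add_squared_le:
  assumes "square_integrable M f" "square_integrable M g"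
  shows "(\<integral>x. (norm (f x + g x))\<^sup>2 \<partial>M)
    \<le> 2 * (\<integral>x. (norm (f x))\<^sup>2 \<partial>M) + 2 * (\<integral>x. (norm (g x))\<^sup>2 \<partial>M)"
proof -
  have "(\<integral>x. (norm (f x + g x))\<^sup>2 \<partial>M) \<le> (\<integral>x. 2 * (norm (f x))\<^sup>2 + 2 * (norm (g x))\<^sup>2 \<partial>M)"
    using square_integrableD(2)[OF assms(1)] square_integrableD(2)[OF assms(2)]
      square_integrableD(2)[OF square_integrable_add[OF assms]]
    by (intro integral_mono) (auto intro: norm_add_squared_le)
  then show ?thesis
    using square_integrableD(2)[OF assms(1)] square_integrableD(2)[OF assms(2)] by simp
qed

text \<open>Young's inequality stands in for Cauchy--Schwarz, to avoid square roots.\<close>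

lemma integral_inner_le:
  assumes fg: "square_integrable M f" "square_integrable M g"
    and le: "(\<integral>x. (norm (f x))\<^sup>2 \<partial>M) \<le> \<epsilon>\<^sup>2" and \<epsilon>: "\<epsilon> > 0"
  shows "(\<integral>x. f x \<bullet> g x \<partial>M) \<le> \<epsilon> * (1 + (\<integral>x. (norm (g x))\<^sup>2 \<partial>M))"
proof -
  note i = square_integrableD(2)[OF fg(1)] square_integrableD(2)[OF fg(2)] square_integrable_inner[OF fg]
  have "f x \<bullet> g x \<le> (norm (f x))\<^sup>2 / \<epsilon> + \<epsilon> * (norm (g x))\<^sup>2" for x
  proof -
    have "f x \<bullet> g x \<le> norm (f x) * norm (g x)" by (rule norm_cauchy_schwarz)
    moreover have "0 \<le> (norm (f x) / \<epsilon> - norm (g x))\<^sup>2 * \<epsilon>" using \<epsilon> by simp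
    moreover have "(norm (f x) / \<epsilon> - norm (g x))\<^sup>2 * \<epsilon>
        = (norm (f x))\<^sup>2 / \<epsilon> + \<epsilon> * (norm (g x))\<^sup>2 - 2 * (norm (f x) * norm (g x))"
      using \<epsilon> by (simp add: power2_eq_square field_simps)
    moreover have "0 \<le> norm (f x) * norm (g x)" by simp
    ultimately show ?thesis by linarith
  qed
  then have "(\<integral>x. f x \<bullet> g x \<partial>M) \<le> (\<integral>x. (norm (f x))\<^sup>2 / \<epsilon> + \<epsilon> * (norm (g x))\<^sup>2 \<partial>M)"
    using i by (intro integral_mono) auto
  also have "\<dots> = (\<integral>x. (norm (f x))\<^sup>2 \<partial>M) / \<epsilon> + \<epsilon> * (\<integral>x. (norm (g x))\<^sup>2 \<partial>M)"
    using i by simp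
  also have "(\<integral>x. (norm (f x))\<^sup>2 \<partial>M) / \<epsilon> \<le> \<epsilon>"
    using le \<epsilon> by (simp add: divide_le_eq power2_eq_square)
  finally show ?thesis by (simp add: algebra_simps)
qed

lemma square_integrable_id_P2: "\<mu> \<in> P2 \<Longrightarrow> square_integrable \<mu> (\<lambda>x. x)"
  by (auto simp: P2_def square_integrable_def cong: measurable_cong_sets)

lemma L2_iff_square_integrable: "f \<in> L2 \<mu> \<longleftrightarrow> square_integrable \<mu> f"
  by (simp add: L2_def square_integrable_def)

section \<open>Push-forwards, couplings and upper bounds for \<open>W2\<close>\<close>

lemma distr_in_P2:
  assumes "prob_space M" "square_integrable M f"
  shows "distr M borel f \<in> P2"
  using assms prob_space.prob_space_distr[OF assms(1), of f borel]
  by (auto simp: P2_def square_integrable_def integrable_distr_eq)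

lemma measurable_Pair_borel:
  fixes f g :: "'b \<Rightarrow> 'a::euclidean_space"
  assumes "f \<in> borel_measurable M" "g \<in> borel_measurable M"
  shows "(\<lambda>x. (f x, g x)) \<in> M \<rightarrow>\<^sub>M borel"
  using assms by simp

lemma measurable_fst_snd_borel [measurable]:
  "fst \<in> (borel :: ('a::euclidean_space \<times> 'a) measure) \<rightarrow>\<^sub>M borel"
  "snd \<in> (borel :: ('a::euclidean_space \<times> 'a) measure) \<rightarrow>\<^sub>M borel"
  by (auto intro!: borel_measurable_continuous_onI continuous_intros)

lemma distr_Pair_in_couplings:
  assumes "prob_space M" and [measurable]: "f \<in> borel_measurable M" "g \<in> borel_measurable M"
  shows "distr M borel (\<lambda>x. (f x, g x)) \<in> couplings (distr M borel f) (distr M borel g)"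
  using prob_space.prob_space_distr[OF assms(1) measurable_Pair_borel[OF assms(2,3)]]
  by (auto simp: couplings_def distr_distr comp_def)


lemma W2_le:
  assumes "\<gamma> \<in> couplings \<mu> \<nu>" "(\<integral>p. (dist (fst p) (snd p))\<^sup>2 \<partial>\<gamma>) \<le> c\<^sup>2" "0 \<le> c"
  shows "W2 \<mu> \<nu> \<le> c"
proof -
  have "(INF \<gamma>\<in>couplings \<mu> \<nu>. \<integral>p. (dist (fst p) (snd p))\<^sup>2 \<partial>\<gamma>)
      \<le> (\<integral>p. (dist (fst p) (snd p))\<^sup>2 \<partial>\<gamma>)"
    by (rule cINF_lower[OF _ assms(1)]) (auto intro!: bdd_belowI[of _ 0])
  then show ?thesis
    unfolding W2_def using assms(2,3) by (intro real_le_lsqrt) auto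
qed

text \<open>Two random variables on one probability space form a coupling of their laws. Distance
  estimates thereby become L2 estimates, and no optimal plan has to be found.\<close>

lemma W2_distr_le:
  assumes "prob_space M" and f[measurable]: "f \<in> borel_measurable M" "g \<in> borel_measurable M"
    and "(\<integral>x. (norm (f x - g x))\<^sup>2 \<partial>M) \<le> c\<^sup>2" "0 \<le> c"
  shows "W2 (distr M borel f) (distr M borel g) \<le> c"
  using assms(4,5) measurable_Pair_borel[OF f]
  by (intro W2_le[OF distr_Pair_in_couplings[OF assms(1) f]]) (auto simp: integral_distr dist_norm)

lemma W2_refl_le: "\<mu> \<in> P2 \<Longrightarrow> W2 \<mu> \<mu> \<le> 0"
  using W2_distr_le[of \<mu> "\<lambda>x. x" "\<lambda>x. x" 0]
  by (auto simp: P2_def distr_id2 cong: measurable_cong_sets)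

lemma distr_pair_snd:
  assumes "prob_space M" "prob_space N"
  shows "distr (M \<Otimes>\<^sub>M N) N snd = N"
proof -
  interpret M: prob_space M by fact
  interpret N: prob_space N by fact
  interpret pair_prob_space M N ..
  show ?thesis
    by (subst distr_pair_swap) (auto simp: distr_distr comp_def case_prod_beta M.distr_pair_fst)
qed

text \<open>The independent coupling, with one factor pushed forward by \<open>U\<close>. With
  \<open>U\<close> the identity it is the product coupling; with a cell law for \<open>M\<close> it
  couples, inside one cell, a variable with an iterated midpoint law.\<close>

lemma distr_pair_in_couplings:
  assumes "prob_space M" "prob_space \<rho>" and s[measurable_cong]: "sets \<rho> = sets borel"
    and [measurable]: "U \<in> borel_measurable M"
  shows "distr (M \<Otimes>\<^sub>M \<rho>) borel (\<lambda>p. (U (fst p), snd p)) \<in> couplings (distr M borel U) \<rho>"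
proof -
  interpret M: prob_space M by fact
  interpret N: prob_space \<rho> by fact
  interpret pair_prob_space M \<rho> ..
  have "distr (distr (M \<Otimes>\<^sub>M \<rho>) M fst) borel U = distr (M \<Otimes>\<^sub>M \<rho>) borel (\<lambda>p. U (fst p))"
    by (subst distr_distr) (auto simp: comp_def)
  then have "distr (M \<Otimes>\<^sub>M \<rho>) borel (\<lambda>p. U (fst p)) = distr M borel U"
    by (simp add: N.distr_pair_fst)
  moreover have "distr (M \<Otimes>\<^sub>M \<rho>) borel snd = distr (M \<Otimes>\<^sub>M \<rho>) \<rho> snd"
    using s by (auto intro: distr_cong)
  then have "distr (M \<Otimes>\<^sub>M \<rho>) borel snd = \<rho>"
    using distr_pair_snd[OF assms(1,2)] by simp
  ultimately show ?thesis
    using distr_Pair_in_couplings[OF P.prob_space_axioms, of "\<lambda>p. U (fst p)" snd] by simp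
qed

lemma W2_less_coupling:
  assumes "\<mu> \<in> P2" "\<nu> \<in> P2" "W2 \<mu> \<nu> < r" 
  obtains \<gamma> where "\<gamma> \<in> couplings \<mu> \<nu>" "(\<integral>p. (dist (fst p) (snd p))\<^sup>2 \<partial>\<gamma>) < r\<^sup>2"
proof -
  interpret \<mu>: prob_space \<mu> using assms by (simp add: P2_def)
  interpret \<nu>: prob_space \<nu> using assms by (simp add: P2_def)
  have s: "sets \<mu> = sets borel" "sets \<nu> = sets borel" using assms by (auto simp: P2_def)
  have "distr \<mu> borel (\<lambda>x. x) = \<mu>" using s by (metis distr_id2)
  \<comment> \<open>The product coupling makes the set nonempty; on an empty set the real infimum
    would be a meaningless default.\<close>
  then have *: "distr (\<mu> \<Otimes>\<^sub>M \<nu>) borel (\<lambda>p. (fst p, snd p)) \<in> couplings \<mu> \<nu>"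
    using distr_pair_in_couplings[OF \<mu>.prob_space_axioms \<nu>.prob_space_axioms s(2), of "\<lambda>x. x"] s
    by (simp cong: measurable_cong_sets)
  have "(INF \<gamma>\<in>couplings \<mu> \<nu>. \<integral>p. (dist (fst p) (snd p))\<^sup>2 \<partial>\<gamma>) < r\<^sup>2"
  proof -
    have "0 \<le> (INF \<gamma>\<in>couplings \<mu> \<nu>. \<integral>p. (dist (fst p) (snd p))\<^sup>2 \<partial>\<gamma>)"
      using * by (intro cINF_greatest) auto
    then show ?thesis
      using assms(3) power_strict_mono[of "W2 \<mu> \<nu>" r 2] by (simp add: W2_def)
  qed
  then show ?thesis
    using * that by (subst (asm) cINF_less_iff) (auto intro!: bdd_belowI[of _ 0])
qed

lemma convex_along_plans_distr:
  assumes "convex_along_plans G" "prob_space M" "square_integrable M f" "square_integrable M g"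
    "0 \<le> t" "t \<le> 1"
  shows "G (distr M borel (\<lambda>x. (1 - t) *\<^sub>R f x + t *\<^sub>R g x))
    \<le> ereal (1 - t) * G (distr M borel f) + ereal t * G (distr M borel g)"
proof -
  have [measurable]: "f \<in> borel_measurable M" "g \<in> borel_measurable M"
    using assms by (auto simp: square_integrable_def)
  have "G (distr (distr M borel (\<lambda>x. (f x, g x))) borel (\<lambda>p. (1 - t) *\<^sub>R fst p + t *\<^sub>R snd p))
    \<le> ereal (1 - t) * G (distr M borel f) + ereal t * G (distr M borel g)"
    using assms(1) distr_in_P2[OF assms(2,3)] distr_in_P2[OF assms(2,4)]
      distr_Pair_in_couplings[OF assms(2), of f g] assms(5,6)
    unfolding convex_along_plans_def by auto
  then show ?thesis
    using measurable_Pair_borel[of f M g] by (subst (asm) distr_distr) (auto simp: comp_def)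
qed

subsection \<open>Midpoints of independent samples\<close>

text \<open>Cell labels carry the full power set as \<sigma>-algebra, so every family of probability
  measures is a kernel and \<open>bind\<close> applies without a measurability condition in the
  index.\<close>

lemma measurable_kernel_UNIV:
  assumes "sets P = UNIV" "\<And>i. prob_space (K i)" "\<And>i. sets (K i) = sets N"
  shows "K \<in> P \<rightarrow>\<^sub>M subprob_algebra N"
proof -
  have "K \<in> count_space UNIV \<rightarrow>\<^sub>M subprob_algebra N"
    using assms by (auto simp: space_subprob_algebra prob_space_imp_subprob_space)
  then show ?thesis
    using assms(1) by (subst measurable_cong_sets[of P "count_space UNIV"]) auto
qed

lemma prob_space_bind_UNIV:
  assumes "prob_space P" "sets P = UNIV" "\<And>i. prob_space (K i)" "\<And>i. sets (K i) = sets N"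
  shows "prob_space (P \<bind> K)" "sets (P \<bind> K) = sets N"
  using assms prob_space.prob_space_bind[OF assms(1) _ measurable_kernel_UNIV[OF assms(2-4)]]
    prob_space.not_empty[OF assms(1)]
  by auto

text \<open>Taking a marginal commutes with \<open>bind\<close>, so a label followed by a pair from
  its coupling gives a coupling of the mixtures. All plans between mixtures below arise in this
  way.\<close>

lemma bind_in_couplings:
  assumes P: "prob_space P" "sets P = UNIV" and \<kappa>: "\<And>i. \<kappa> i \<in> couplings (\<alpha> i) (\<beta> i)"
  shows "P \<bind> \<kappa> \<in> couplings (P \<bind> \<alpha>) (P \<bind> \<beta>)"
proof -
  have k: "prob_space (\<kappa> i)" "sets (\<kappa> i) = sets borel" 
    "distr (\<kappa> i) borel fst = \<alpha> i" "distr (\<kappa> i) borel snd = \<beta> i" for i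
    using \<kappa>[of i] by (auto simp: couplings_def)
  note m = measurable_kernel_UNIV[of P \<kappa>, OF P(2) k(1,2)]
  show ?thesis
    using prob_space_bind_UNIV[of P \<kappa>, OF P k(1,2)] k(3,4) prob_space.not_empty[OF P(1)]
      distr_bind[OF m _ measurable_fst_snd_borel(1)] distr_bind[OF m _ measurable_fst_snd_borel(2)]
    by (simp add: couplings_def)
qed


section \<open>Contraction of the variance under midpoints\<close>

definition iid_midpoint :: "'a::euclidean_space measure \<Rightarrow> 'a measure" where
  "iid_midpoint \<rho> = distr (\<rho> \<Otimes>\<^sub>M \<rho>) borel (\<lambda>p. (1/2) *\<^sub>R fst p + (1/2) *\<^sub>R snd p)"

text \<open>\<open>V\<close> is the scalar variance, the trace of the covariance matrix. Bundled
  with the mean it forms a property that can be carried through the iteration of midpoints.\<close>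

definition has_mean_variance :: "'a::euclidean_space measure \<Rightarrow> 'a \<Rightarrow> real \<Rightarrow> bool" where
  "has_mean_variance \<rho> c V \<longleftrightarrow> prob_space \<rho> \<and> sets \<rho> = sets borel \<and>
     square_integrable \<rho> (\<lambda>z. z) \<and> (\<integral>z. z \<partial>\<rho>) = c \<and> (\<integral>z. (norm (z - c))\<^sup>2 \<partial>\<rho>) = V"

text \<open>For the midpoint m of independent x and y, |m - c|^2 = |x - c|^2/4 + |y - c|^2/4 + (x -
  c) \<bullet> (y - c)/2. The last term integrates to 0 by Fubini, which leaves V/4 + V/4.\<close>

lemma has_mean_variance_iid_midpoint:
  assumes "has_mean_variance \<rho> c V"
  shows "has_mean_variance (iid_midpoint \<rho>) c (V / 2)"
proof -
  interpret \<rho>: prob_space \<rho> using assms by (simp add: has_mean_variance_def)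
  interpret pair_prob_space \<rho> \<rho> ..
  have s[measurable_cong]: "sets \<rho> = sets borel" and si: "square_integrable \<rho> (\<lambda>z. z)"
    and c: "(\<integral>z. z \<partial>\<rho>) = c" and V: "(\<integral>z. (norm (z - c))\<^sup>2 \<partial>\<rho>) = V"
    using assms by (auto simp: has_mean_variance_def)
  have i: "integrable \<rho> (\<lambda>z. z)" by (rule \<rho>.square_integrable_imp_integrable[OF si])
  have sc: "square_integrable \<rho> (\<lambda>z. z - c)"
    by (intro square_integrable_diff si \<rho>.square_integrable_bounded[of _ "norm c"]) auto
  have fst_eq: "distr (\<rho> \<Otimes>\<^sub>M \<rho>) \<rho> fst = \<rho>" by (rule \<rho>.distr_pair_fst)
  have snd_eq: "distr (\<rho> \<Otimes>\<^sub>M \<rho>) \<rho> snd = \<rho>" by (rule distr_pair_snd) unfold_locales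
  have sq: "square_integrable (\<rho> \<Otimes>\<^sub>M \<rho>) (\<lambda>p. f (fst p)) \<and> square_integrable (\<rho> \<Otimes>\<^sub>M \<rho>) (\<lambda>p. f (snd p))"
    if "square_integrable \<rho> f" for f :: "'a \<Rightarrow> 'a"
    using that square_integrable_distr[of fst "\<rho> \<Otimes>\<^sub>M \<rho>" \<rho> f] square_integrable_distr[of snd "\<rho> \<Otimes>\<^sub>M \<rho>" \<rho> f]
    by (simp add: fst_eq snd_eq square_integrable_def)
  have int: "integral\<^sup>L (\<rho> \<Otimes>\<^sub>M \<rho>) (\<lambda>p. f (fst p)) = integral\<^sup>L \<rho> f"
      "integral\<^sup>L (\<rho> \<Otimes>\<^sub>M \<rho>) (\<lambda>p. f (snd p)) = integral\<^sup>L \<rho> f"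
    if "f \<in> borel_measurable \<rho>" for f :: "'a \<Rightarrow> 'z::euclidean_space"
    using that integral_distr[of fst "\<rho> \<Otimes>\<^sub>M \<rho>" \<rho> f] integral_distr[of snd "\<rho> \<Otimes>\<^sub>M \<rho>" \<rho> f]
    by (simp_all add: fst_eq snd_eq)
  let ?m = "\<lambda>p. (1/2) *\<^sub>R fst p + (1/2) *\<^sub>R snd p :: 'a"
  have sm: "square_integrable (\<rho> \<Otimes>\<^sub>M \<rho>) ?m"
    using sq[OF si] by (intro square_integrable_add square_integrable_scaleR) auto
  have "(\<integral>p. (fst p - c) \<bullet> (snd p - c) \<partial>(\<rho> \<Otimes>\<^sub>M \<rho>)) = (\<integral>x. \<integral>y. (x - c) \<bullet> (y - c) \<partial>\<rho> \<partial>\<rho>)"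
    using integral_fst'[of "\<lambda>p. (fst p - c) \<bullet> (snd p - c)"] square_integrable_inner[OF conjunct1[OF sq[OF sc]] conjunct2[OF sq[OF sc]]]
    by simp
  also have "\<dots> = (\<integral>x. (x - c) \<bullet> (\<integral>y. y - c \<partial>\<rho>) \<partial>\<rho>)"
    using i by (intro Bochner_Integration.integral_cong refl integral_inner_right) auto
  also have "(\<integral>y. y - c \<partial>\<rho>) = 0"
    using i c \<rho>.prob_space by simp
  finally have cross: "(\<integral>p. (fst p - c) \<bullet> (snd p - c) \<partial>(\<rho> \<Otimes>\<^sub>M \<rho>)) = 0" by simp
  have "(norm (?m p - c))\<^sup>2 = (norm (fst p - c))\<^sup>2 / 4 + (norm (snd p - c))\<^sup>2 / 4
      + ((fst p - c) \<bullet> (snd p - c)) / 2" for p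
  proof -
    have "?m p - c = (1/2) *\<^sub>R ((fst p - c) + (snd p - c))"
      by (simp add: algebra_simps flip: scaleR_add_left)
    then have "(norm (?m p - c))\<^sup>2 = (norm ((fst p - c) + (snd p - c)))\<^sup>2 / 4"
      by (simp add: power_divide)
    also have "(norm ((fst p - c) + (snd p - c)))\<^sup>2
        = (norm (fst p - c))\<^sup>2 + (norm (snd p - c))\<^sup>2 + 2 * ((fst p - c) \<bullet> (snd p - c))"
      by (simp only: power2_norm_eq_inner inner_add inner_commute)
    finally show ?thesis by (simp add: add_divide_distrib)
  qed
  then have "(\<integral>p. (norm (?m p - c))\<^sup>2 \<partial>(\<rho> \<Otimes>\<^sub>M \<rho>)) = (\<integral>p. (norm (fst p - c))\<^sup>2 / 4 + (norm (snd p - c))\<^sup>2 / 4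
      + ((fst p - c) \<bullet> (snd p - c)) / 2 \<partial>(\<rho> \<Otimes>\<^sub>M \<rho>))" by simp
  also have "\<dots> = (\<integral>p. (norm (fst p - c))\<^sup>2 \<partial>(\<rho> \<Otimes>\<^sub>M \<rho>)) / 4 + (\<integral>p. (norm (snd p - c))\<^sup>2 \<partial>(\<rho> \<Otimes>\<^sub>M \<rho>)) / 4
      + (\<integral>p. (fst p - c) \<bullet> (snd p - c) \<partial>(\<rho> \<Otimes>\<^sub>M \<rho>)) / 2"
    using sq[OF sc] square_integrable_inner[of _ "\<lambda>p. fst p - c" "\<lambda>p. snd p - c"]
    by (simp add: square_integrable_def)
  also have "\<dots> = V / 2"
    using cross int[of "\<lambda>x. (norm (x - c))\<^sup>2"] V by simp
  finally have v: "(\<integral>p. (norm (?m p - c))\<^sup>2 \<partial>(\<rho> \<Otimes>\<^sub>M \<rho>)) = V / 2" .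
  have mm: "?m \<in> borel_measurable (\<rho> \<Otimes>\<^sub>M \<rho>)" using sm by (simp add: square_integrable_def)
  have "integrable (\<rho> \<Otimes>\<^sub>M \<rho>) (\<lambda>p. fst p)" "integrable (\<rho> \<Otimes>\<^sub>M \<rho>) (\<lambda>p. snd p)"
    using sq[OF si] P.square_integrable_imp_integrable by auto
  then have "(\<integral>p. ?m p \<partial>(\<rho> \<Otimes>\<^sub>M \<rho>)) = (1/2) *\<^sub>R c + (1/2) *\<^sub>R c"
    using int[of "\<lambda>z. z"] c by simp
  then have "(\<integral>p. ?m p \<partial>(\<rho> \<Otimes>\<^sub>M \<rho>)) = c"
    by (simp flip: scaleR_add_left)
  then show ?thesis
    using v mm sm P.prob_space_distr[OF mm]
    by (simp add: has_mean_variance_def iid_midpoint_def integral_distr square_integrable_distr)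
qed

lemma has_mean_variance_funpow_iid_midpoint:
  assumes "has_mean_variance \<rho> c V"
  shows "has_mean_variance ((iid_midpoint ^^ m) \<rho>) c (V / 2 ^ m)"
  by (induction m) (use assms has_mean_variance_iid_midpoint in \<open>force simp: mult.commute\<close>)+

text \<open>Splitting u - z through the mean \<open>c\<close> costs a factor 2, which reappears in
  the hypothesis \<open>near\<close> of \<open>cell_mean_le\<close>. The Lebesgue form lets the
  bound be integrated over a mixture.\<close>

lemma has_mean_variance_nn_integral_le:
  assumes "has_mean_variance \<rho> c V"
  shows "(\<integral>\<^sup>+z. ennreal ((norm (u - z))\<^sup>2) \<partial>\<rho>) \<le> ennreal (2 * (norm (u - c))\<^sup>2 + 2 * V)"
proof -
  interpret \<rho>: prob_space \<rho> using assms by (simp add: has_mean_variance_def)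
  have s[measurable_cong]: "sets \<rho> = sets borel" and si: "square_integrable \<rho> (\<lambda>z. z)"
    and V: "(\<integral>z. (norm (z - c))\<^sup>2 \<partial>\<rho>) = V"
    using assms by (auto simp: has_mean_variance_def)
  have a: "square_integrable \<rho> (\<lambda>z. c - z)" "square_integrable \<rho> (\<lambda>_. u - c)" "square_integrable \<rho> (\<lambda>_. u)"
    by (intro square_integrable_diff si \<rho>.square_integrable_bounded[OF _ order_refl]; simp)+
  have "(\<integral>\<^sup>+z. ennreal ((norm (u - z))\<^sup>2) \<partial>\<rho>) = ennreal (\<integral>z. (norm (u - z))\<^sup>2 \<partial>\<rho>)"
    using square_integrable_diff[OF a(3) si] by (intro nn_integral_eq_integral) (auto simp: square_integrable_def)
  also have "(\<integral>z. (norm (u - z))\<^sup>2 \<partial>\<rho>) \<le> 2 * (norm (u - c))\<^sup>2 + 2 * V"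
    using integral_norm_add_squared_le[OF a(2,1)] V \<rho>.prob_space by (simp add: norm_minus_commute)
  finally show ?thesis by (simp add: ennreal_leI)
qed

subsection \<open>Conditional laws on finitely many cells\<close>

text \<open>On a null cell the conditional law is replaced by the junk value \<open>M\<close>, so that it is a
  probability measure for every index.\<close>

definition cell_law :: "'b measure \<Rightarrow> ('b \<Rightarrow> 'c) \<Rightarrow> 'c \<Rightarrow> 'b measure" where
  "cell_law M S i = (let A = {\<omega>\<in>space M. S \<omega> = i} in
     if emeasure M A = 0 then M else uniform_measure M A)"

lemma cell_sets:
  assumes "simple_function M S"
  shows "{\<omega>\<in>space M. S \<omega> = i} \<in> sets M"
  using measurable_sets[OF measurable_simple_function[OF assms], of "{i}"]
  by (simp add: vimage_def Int_def conj_commute)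

lemma sets_cell_law [simp, measurable_cong]: "sets (cell_law M S i) = sets M"
  by (simp add: cell_law_def Let_def)

lemma (in prob_space) prob_space_cell_law: "prob_space (cell_law M S i)"
  using prob_space_axioms by (auto simp: cell_law_def Let_def intro!: prob_space_uniform_measure)

lemma sum_indicator_cells:
  fixes f :: "'b \<Rightarrow> 'd::semiring_1"
  assumes "simple_function M S" "\<omega> \<in> space M"
  shows "(\<Sum>i\<in>S ` space M. f \<omega> * indicator {\<omega>\<in>space M. S \<omega> = i} \<omega>) = f \<omega>"
proof -
  have "(\<Sum>i\<in>S ` space M. f \<omega> * indicator {\<omega>\<in>space M. S \<omega> = i} \<omega>)
      = (\<Sum>i\<in>{S \<omega>}. f \<omega> * indicator {\<omega>\<in>space M. S \<omega> = i} \<omega>)"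
    using assms by (intro sum.mono_neutral_right) (auto simp: simple_function_def indicator_def)
  then show ?thesis using assms by simp
qed

lemma nn_integral_cells:
  assumes S: "simple_function M S" and f: "f \<in> borel_measurable M"
  shows "(\<integral>\<^sup>+\<omega>. f \<omega> \<partial>M)
    = (\<Sum>i\<in>S ` space M. \<integral>\<^sup>+\<omega>. f \<omega> * indicator {\<omega>\<in>space M. S \<omega> = i} \<omega> \<partial>M)"
proof -
  have "(\<integral>\<^sup>+\<omega>. f \<omega> \<partial>M)
      = (\<integral>\<^sup>+\<omega>. (\<Sum>i\<in>S ` space M. f \<omega> * indicator {\<omega>\<in>space M. S \<omega> = i} \<omega>) \<partial>M)"
    by (intro nn_integral_cong) (simp add: sum_indicator_cells[OF S])
  then show ?thesis
    using f cell_sets[OF S] by (simp add: nn_integral_sum)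
qed

text \<open>Multiplied out by the mass of the cell, the formula for the conditional law also covers
  null cells, where both sides vanish.\<close>

lemma (in prob_space) nn_integral_cell_law:
  assumes S: "simple_function M S" and f: "f \<in> borel_measurable M"
  shows "(\<integral>\<^sup>+\<omega>. f \<omega> \<partial>cell_law M S i) * emeasure M {\<omega>\<in>space M. S \<omega> = i}
    = (\<integral>\<^sup>+\<omega>. f \<omega> * indicator {\<omega>\<in>space M. S \<omega> = i} \<omega> \<partial>M)" (is "_ * emeasure M ?A = _")
proof (cases "emeasure M ?A = 0")
  case True
  then have "AE \<omega> in M. \<omega> \<notin> ?A" using cell_sets[OF S] by (auto simp: AE_iff_null null_sets_def)
  then have "(\<integral>\<^sup>+\<omega>. f \<omega> * indicator ?A \<omega> \<partial>M) = (\<integral>\<^sup>+\<omega>. 0 \<partial>M)"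
    by (intro nn_integral_cong_AE) (auto simp: indicator_def)
  then show ?thesis using True by simp
next
  case False
  then show ?thesis
    using cell_sets[OF S, of i] f
    by (simp add: cell_law_def nn_integral_uniform_measure ennreal_divide_times less_top[symmetric])
qed

text \<open>The law of total expectation for a finite partition, with an integrand that may depend
  on the label: on the cell of label i one has S \<omega> = i.\<close>

lemma (in prob_space) nn_integral_cells_cell_law:
  assumes S: "simple_function M S" and f: "\<And>i. f i \<in> borel_measurable M"
  shows "(\<integral>\<^sup>+i. \<integral>\<^sup>+\<omega>. f i \<omega> \<partial>cell_law M S i \<partial>distr M (count_space UNIV) S) = (\<integral>\<^sup>+\<omega>. f (S \<omega>) \<omega> \<partial>M)"
proof -
  note Sm = measurable_simple_function[OF S]
  let ?A = "\<lambda>i. {\<omega>\<in>space M. S \<omega> = i}"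
  \<comment> \<open>The family \<open>f\<close> is measurable for each label separately, not
    jointly, so the map is written as a finite sum over cells.\<close>
  have fS: "(\<lambda>\<omega>. f (S \<omega>) \<omega>) \<in> borel_measurable M"
  proof -
    have "(\<lambda>\<omega>. \<Sum>i\<in>S ` space M. f i \<omega> * indicator (?A i) \<omega>) \<in> borel_measurable M"
      using f cell_sets[OF S] by simp
    also have "?this \<longleftrightarrow> ?thesis"
    proof (rule measurable_cong)
      fix \<omega> assume w: "\<omega> \<in> space M"
      have "(\<Sum>i\<in>S ` space M. f i \<omega> * indicator (?A i) \<omega>) = (\<Sum>i\<in>S ` space M. f (S \<omega>) \<omega> * indicator (?A i) \<omega>)"
        by (intro sum.cong) (auto simp: indicator_def)
      then show "(\<Sum>i\<in>S ` space M. f i \<omega> * indicator (?A i) \<omega>) = f (S \<omega>) \<omega>"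
        using sum_indicator_cells[OF S w, of "\<lambda>\<omega>. f (S \<omega>) \<omega>"] by simp
    qed
    finally show ?thesis .
  qed
  have "(\<integral>\<^sup>+i. \<integral>\<^sup>+\<omega>. f i \<omega> \<partial>cell_law M S i \<partial>distr M (count_space UNIV) S)
      = (\<integral>\<^sup>+\<omega>'. \<integral>\<^sup>+\<omega>. f (S \<omega>') \<omega> \<partial>cell_law M S (S \<omega>') \<partial>M)"
    using Sm by (simp add: nn_integral_distr)
  also have "\<dots> = (\<Sum>i\<in>S ` space M. \<integral>\<^sup>+\<omega>'. (\<integral>\<^sup>+\<omega>. f (S \<omega>') \<omega> \<partial>cell_law M S (S \<omega>')) * indicator (?A i) \<omega>' \<partial>M)"
    by (intro nn_integral_cells[OF S] measurable_compose[OF Sm]) simp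
  also have "\<dots> = (\<Sum>i\<in>S ` space M. \<integral>\<^sup>+\<omega>'. (\<integral>\<^sup>+\<omega>. f i \<omega> \<partial>cell_law M S i) * indicator (?A i) \<omega>' \<partial>M)"
    by (intro sum.cong nn_integral_cong refl) (auto simp: indicator_def)
  also have "\<dots> = (\<Sum>i\<in>S ` space M. \<integral>\<^sup>+\<omega>. f i \<omega> * indicator (?A i) \<omega> \<partial>M)"
    using cell_sets[OF S] by (simp add: nn_integral_cmult_indicator nn_integral_cell_law[OF S f])
  also have "\<dots> = (\<Sum>i\<in>S ` space M. \<integral>\<^sup>+\<omega>. f (S \<omega>) \<omega> * indicator (?A i) \<omega> \<partial>M)"
    by (intro sum.cong nn_integral_cong refl) (auto simp: indicator_def)
  also have "\<dots> = (\<integral>\<^sup>+\<omega>. f (S \<omega>) \<omega> \<partial>M)"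
    by (rule nn_integral_cells[OF S fS, symmetric])
  finally show ?thesis .
qed

text \<open>A label followed by a point of its cell recovers \<open>M\<close>: this is
  disintegration along a finite partition. The junk laws on null cells receive weight zero.\<close>

lemma (in prob_space) bind_cell_law:
  assumes S: "simple_function M S"
  shows "distr M (count_space UNIV) S \<bind> cell_law M S = M"
proof (rule measure_eqI)
  let ?P = "distr M (count_space UNIV) S"
  interpret P: prob_space ?P
    using prob_space_distr[OF measurable_simple_function[OF S]] .
  have m: "cell_law M S \<in> ?P \<rightarrow>\<^sub>M subprob_algebra M"
    by (rule measurable_kernel_UNIV) (simp_all add: prob_space_cell_law)
  show s: "sets (?P \<bind> cell_law M S) = sets M"
    using prob_space_bind_UNIV(2)[of ?P "cell_law M S" M] P.prob_space_axioms
    by (simp add: prob_space_cell_law)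
  fix A assume "A \<in> sets (?P \<bind> cell_law M S)"
  then have A: "A \<in> sets M" using s by simp
  then show "emeasure (?P \<bind> cell_law M S) A = emeasure M A"
    using emeasure_bind[OF P.not_empty m A] nn_integral_cells_cell_law[OF S, of "\<lambda>_. indicator A"]
    by simp
qed

text \<open>Conditioning on a cell of positive mass at most divides the second moment by that mass.
  On a null cell the law is \<open>M\<close> itself, so no label is exceptional.\<close>

lemma (in prob_space) square_integrable_cell_law:
  assumes S: "simple_function M S" and Z: "square_integrable M Z"
  shows "square_integrable (cell_law M S i) Z"
proof (cases "emeasure M {\<omega>\<in>space M. S \<omega> = i} = 0")
  case True
  then show ?thesis using Z by (simp add: cell_law_def)
next
  case False
  note [measurable] = square_integrableD(1)[OF Z]
  let ?A = "{\<omega>\<in>space M. S \<omega> = i}"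
  have "(\<integral>\<^sup>+\<omega>. ennreal ((norm (Z \<omega>))\<^sup>2) * indicator ?A \<omega> \<partial>M) \<le> (\<integral>\<^sup>+\<omega>. ennreal ((norm (Z \<omega>))\<^sup>2) \<partial>M)"
    by (intro nn_integral_mono) (auto simp: indicator_def)
  also have "\<dots> < \<infinity>"
    using Z by (auto simp: square_integrable_def integrable_iff_bounded)
  finally have "(\<integral>\<^sup>+\<omega>. ennreal ((norm (Z \<omega>))\<^sup>2) \<partial>cell_law M S i) < \<infinity>"
    using False cell_sets[OF S, of i]
    by (simp add: cell_law_def nn_integral_uniform_measure ennreal_divide_eq_top_iff flip: less_top)
  then show ?thesis
    by (auto simp: square_integrable_def integrable_iff_bounded)
qed

text \<open>\<open>cell_mean M S Z (S \<omega>)\<close> is the conditional expectation of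
  \<open>Z\<close> given \<open>S\<close>. It is a function of the label, so that it can also be
  composed with a label map on another space.\<close>

definition cell_mean :: "'b measure \<Rightarrow> ('b \<Rightarrow> 'c) \<Rightarrow> ('b \<Rightarrow> 'a::euclidean_space) \<Rightarrow> 'c \<Rightarrow> 'a" where
  "cell_mean M S Z i = (\<integral>\<omega>. Z \<omega> \<partial>cell_law M S i)"

lemma (in prob_space) integral_indicator_cell_mean:
  assumes S: "simple_function M S" and Z: "square_integrable M Z"
  shows "(\<integral>\<omega>. indicator {\<omega>\<in>space M. S \<omega> = i} \<omega> *\<^sub>R Z \<omega> \<partial>M)
    = measure M {\<omega>\<in>space M. S \<omega> = i} *\<^sub>R cell_mean M S Z i" (is "?l = measure M ?A *\<^sub>R _")
proof (cases "emeasure M ?A = 0")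
  case True
  then have "AE \<omega> in M. \<omega> \<notin> ?A" using cell_sets[OF S] by (auto simp: AE_iff_null null_sets_def)
  then have "?l = (\<integral>\<omega>. 0 \<partial>M)"
    using cell_sets[OF S] square_integrableD(1)[OF Z]
    by (intro integral_cong_AE) (auto simp: indicator_def)
  then show ?thesis using True by (simp add: measure_def)
next
  case False
  have A: "?A \<in> sets M" by (rule cell_sets[OF S])
  have p: "measure M ?A \<noteq> 0" using False by (simp add: emeasure_eq_measure)
  have "(\<lambda>\<omega>. indicator ?A \<omega> / emeasure M ?A) = (\<lambda>\<omega>. ennreal (indicator ?A \<omega> / measure M ?A))"
    using p by (auto simp: emeasure_eq_measure indicator_def ennreal_1[symmetric] divide_ennreal zero_less_measure_iff
       simp del: ennreal_1)
  then have "cell_mean M S Z i = (\<integral>\<omega>. (indicator ?A \<omega> / measure M ?A) *\<^sub>R Z \<omega> \<partial>M)"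
    using False A square_integrableD(1)[OF Z]
    by (simp add: cell_mean_def cell_law_def Let_def uniform_measure_def integral_density)
  also have "\<dots> = (\<integral>\<omega>. (1 / measure M ?A) *\<^sub>R (indicator ?A \<omega> *\<^sub>R Z \<omega>) \<partial>M)"
    by simp
  also have "\<dots> = (1 / measure M ?A) *\<^sub>R ?l" by (rule integral_scaleR_right)
  finally show ?thesis using p by simp
qed

lemma square_integrable_cells:
  assumes "prob_space M" "simple_function M S"
  shows "square_integrable M (\<lambda>\<omega>. h (S \<omega>))"
proof -
  interpret prob_space M by fact
  have "simple_function M (\<lambda>\<omega>. h (S \<omega>))"
    using simple_function_compose[OF assms(2), of h] by (simp add: comp_def)
  then show ?thesis
    using finite_subset[of "(\<lambda>\<omega>. h (S \<omega>)) ` space M"]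
    by (intro square_integrable_bounded[where B="Max (norm ` (\<lambda>\<omega>. h (S \<omega>)) ` space M)"])
      (auto intro!: Max_ge borel_measurable_simple_function simp: simple_function_def)
qed

text \<open>A map that is constant on cells is orthogonal to \<open>Z\<close> minus its cell mean.
  Here \<open>h\<close> is arbitrary because \<open>S\<close> has finite range.\<close>

lemma (in prob_space) integral_inner_cell_mean:
  assumes S: "simple_function M S" and Z: "square_integrable M Z"
  shows "(\<integral>\<omega>. h (S \<omega>) \<bullet> cell_mean M S Z (S \<omega>) \<partial>M) = (\<integral>\<omega>. h (S \<omega>) \<bullet> Z \<omega> \<partial>M)"
proof -
  let ?A = "\<lambda>i. {\<omega>\<in>space M. S \<omega> = i}"
  have *: "(\<integral>\<omega>. h (S \<omega>) \<bullet> Y \<omega> \<partial>M) = (\<Sum>i\<in>S ` space M. h i \<bullet> (\<integral>\<omega>. indicator (?A i) \<omega> *\<^sub>R Y \<omega> \<partial>M))"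
    if Y: "square_integrable M Y" for Y
  proof -
    have i: "integrable M (\<lambda>\<omega>. indicator (?A i) \<omega> *\<^sub>R Y \<omega>)" for i
      using square_integrable_imp_integrable[OF Y] cell_sets[OF S]
      by (intro integrable_mult_indicator) auto
    have "(\<integral>\<omega>. h (S \<omega>) \<bullet> Y \<omega> \<partial>M) = (\<integral>\<omega>. (\<Sum>i\<in>S ` space M. h i \<bullet> (indicator (?A i) \<omega> *\<^sub>R Y \<omega>)) \<partial>M)"
    proof (intro Bochner_Integration.integral_cong refl)
      fix \<omega> assume w: "\<omega> \<in> space M"
      have "(\<Sum>i\<in>S ` space M. h i \<bullet> (indicator (?A i) \<omega> *\<^sub>R Y \<omega>))
          = (\<Sum>i\<in>S ` space M. (h (S \<omega>) \<bullet> Y \<omega>) * indicator (?A i) \<omega>)"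
        by (intro sum.cong) (auto simp: indicator_def)
      then show "h (S \<omega>) \<bullet> Y \<omega> = (\<Sum>i\<in>S ` space M. h i \<bullet> (indicator (?A i) \<omega> *\<^sub>R Y \<omega>))"
        using sum_indicator_cells[OF S w, of "\<lambda>\<omega>. h (S \<omega>) \<bullet> Y \<omega>"] by simp
    qed
    also have "\<dots> = (\<Sum>i\<in>S ` space M. \<integral>\<omega>. h i \<bullet> (indicator (?A i) \<omega> *\<^sub>R Y \<omega>) \<partial>M)"
      by (intro Bochner_Integration.integral_sum integrable_inner_right i)
    also have "\<dots> = (\<Sum>i\<in>S ` space M. h i \<bullet> (\<integral>\<omega>. indicator (?A i) \<omega> *\<^sub>R Y \<omega> \<partial>M))"
      by (intro sum.cong refl integral_inner_right i)
    finally show ?thesis .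
  qed
  have "(\<integral>\<omega>. indicator (?A i) \<omega> *\<^sub>R cell_mean M S Z (S \<omega>) \<partial>M) = measure M (?A i) *\<^sub>R cell_mean M S Z i" for i
  proof -
    have "(\<integral>\<omega>. indicator (?A i) \<omega> *\<^sub>R cell_mean M S Z (S \<omega>) \<partial>M) = (\<integral>\<omega>. indicator (?A i) \<omega> *\<^sub>R cell_mean M S Z i \<partial>M)"
      by (intro Bochner_Integration.integral_cong refl) (auto simp: indicator_def)
    also have "\<dots> = measure M (?A i) *\<^sub>R cell_mean M S Z i"
      using cell_sets[OF S, of i] by (subst integral_scaleR_left) (auto simp: sets.Int_space_eq2 less_top[symmetric])
    finally show ?thesis .
  qed
  then show ?thesis
    using *[OF Z] *[OF square_integrable_cells[OF prob_space_axioms S], of "cell_mean M S Z"]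
    by (simp add: integral_indicator_cell_mean[OF S Z])
qed

text \<open>Both bounds are Pythagoras: the cell mean is the orthogonal projection of
  \<open>Z\<close> onto the functions of \<open>S\<close>, hence it does not increase the norm and
  is the best cellwise constant approximation.\<close>

lemma (in prob_space) integral_norm_cell_mean_le:
  assumes S: "simple_function M S" and Z: "square_integrable M Z"
  shows "(\<integral>\<omega>. (norm (cell_mean M S Z (S \<omega>)))\<^sup>2 \<partial>M) \<le> (\<integral>\<omega>. (norm (Z \<omega>))\<^sup>2 \<partial>M)"
    and "(\<integral>\<omega>. (norm (Z \<omega> - cell_mean M S Z (S \<omega>)))\<^sup>2 \<partial>M) \<le> (\<integral>\<omega>. (norm (Z \<omega> - h (S \<omega>)))\<^sup>2 \<partial>M)"
proof -
  let ?c = "\<lambda>\<omega>. cell_mean M S Z (S \<omega>)"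
  have h: "square_integrable M (\<lambda>\<omega>. g (S \<omega>))" for g
    by (rule square_integrable_cells[OF prob_space_axioms S])
  have ex: "(\<integral>\<omega>. (norm (Z \<omega> - g (S \<omega>)))\<^sup>2 \<partial>M)
      = (\<integral>\<omega>. (norm (Z \<omega> - ?c \<omega>))\<^sup>2 \<partial>M) + (\<integral>\<omega>. (norm (?c \<omega> - g (S \<omega>)))\<^sup>2 \<partial>M)" for g
  proof -
    let ?d = "\<lambda>i. cell_mean M S Z i - g i"
    have "(norm (Z \<omega> - g (S \<omega>)))\<^sup>2 = (norm (Z \<omega> - ?c \<omega>))\<^sup>2 + (norm (?c \<omega> - g (S \<omega>)))\<^sup>2
        + 2 * (?d (S \<omega>) \<bullet> Z \<omega> - ?d (S \<omega>) \<bullet> ?c \<omega>)" for \<omega>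
      by (simp add: power2_norm_eq_inner inner_simps inner_commute)
    moreover have "integrable M (\<lambda>\<omega>. ?d (S \<omega>) \<bullet> Z \<omega>)" "integrable M (\<lambda>\<omega>. ?d (S \<omega>) \<bullet> ?c \<omega>)"
        "integrable M (\<lambda>\<omega>. (norm (Z \<omega> - ?c \<omega>))\<^sup>2)" "integrable M (\<lambda>\<omega>. (norm (?d (S \<omega>)))\<^sup>2)"
      using h[of ?d] h[of "cell_mean M S Z"] Z square_integrable_diff[OF Z h[of "cell_mean M S Z"]]
      by (auto intro: square_integrable_inner simp: square_integrable_def)
    ultimately show ?thesis
      using integral_inner_cell_mean[OF S Z, of ?d] by simp
  qed
  show "(\<integral>\<omega>. (norm (?c \<omega>))\<^sup>2 \<partial>M) \<le> (\<integral>\<omega>. (norm (Z \<omega>))\<^sup>2 \<partial>M)"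
    using ex[of "\<lambda>_. 0"] by simp
  show "(\<integral>\<omega>. (norm (Z \<omega> - ?c \<omega>))\<^sup>2 \<partial>M) \<le> (\<integral>\<omega>. (norm (Z \<omega> - h (S \<omega>)))\<^sup>2 \<partial>M)"
    using ex[of h] by simp
qed

subsection \<open>Averaging over cells\<close>

text \<open>Costs of mixed couplings are computed through \<open>nn_integral_bind\<close>, hence as
  Lebesgue integrals; this is the passage back to the real integral in \<open>W2\<close>.\<close>

lemma W2_le_nn_integral:
  fixes \<mu> \<nu> :: "'a::euclidean_space measure"
  assumes "\<gamma> \<in> couplings \<mu> \<nu>" "0 \<le> c"
    "(\<integral>\<^sup>+p. ennreal ((norm (fst p - snd p))\<^sup>2) \<partial>\<gamma>) \<le> ennreal (c\<^sup>2)"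
  shows "W2 \<mu> \<nu> \<le> c"
proof (rule W2_le[OF assms(1) _ assms(2)])
  have "sets \<gamma> = sets borel" using assms(1) by (simp add: couplings_def)
  then have [measurable]: "fst \<in> borel_measurable \<gamma>" "snd \<in> borel_measurable \<gamma>"
    using measurable_fst_snd_borel[where 'a='a] by (auto cong: measurable_cong_sets)
  have "(\<integral>p. (norm (fst p - snd p))\<^sup>2 \<partial>\<gamma>) = enn2real (\<integral>\<^sup>+p. ennreal ((norm (fst p - snd p))\<^sup>2) \<partial>\<gamma>)"
    by (rule integral_eq_nn_integral) auto
  also have "\<dots> \<le> enn2real (ennreal (c\<^sup>2))"
    using assms(3) by (intro enn2real_mono) auto
  finally show "(\<integral>p. (dist (fst p) (snd p))\<^sup>2 \<partial>\<gamma>) \<le> c\<^sup>2" by (simp add: dist_norm)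
qed

lemma ereal_half_plus_half:
  "ereal (1/2) * x + ereal (1/2) * x = x"
  by (cases x) auto

text \<open>A label followed by two independent points of the same law \<rho> i is a plan from the
  mixture to itself. Its midpoint law is the mixture of the iid midpoints, and convexity at t = 1/2
  has the same value of \<open>G\<close> twice on the right.\<close>

lemma convex_along_plans_iid_midpoint:
  assumes G: "convex_along_plans G" and P: "prob_space P" "sets P = UNIV"
    and \<rho>: "\<And>i. prob_space (\<rho> i)" "\<And>i. sets (\<rho> i) = sets borel" and P2: "P \<bind> \<rho> \<in> P2"
  shows "G (P \<bind> (\<lambda>i. iid_midpoint (\<rho> i))) \<le> G (P \<bind> \<rho>)"
proof -
  define \<kappa> where "\<kappa> = (\<lambda>i. distr (\<rho> i \<Otimes>\<^sub>M \<rho> i) borel (\<lambda>p. (fst p, snd p)))"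
  have "distr (\<rho> i) borel (\<lambda>x. x) = \<rho> i" for i
    by (metis \<rho>(2) distr_id2)
  then have \<kappa>: "\<kappa> i \<in> couplings (\<rho> i) (\<rho> i)" for i
    using distr_pair_in_couplings[of "\<rho> i" "\<rho> i" "\<lambda>x. x"] \<rho> unfolding \<kappa>_def
    by (auto cong: measurable_cong_sets)
  have k: "prob_space (\<kappa> i)" "sets (\<kappa> i) = sets borel" for i
    using \<kappa>[of i] by (auto simp: couplings_def)
  have m[measurable]: "(\<lambda>p. (1/2) *\<^sub>R fst p + (1/2) *\<^sub>R snd p) \<in> (borel :: ('a \<times> 'a) measure) \<rightarrow>\<^sub>M borel"
    by measurable
  have "distr (P \<bind> \<kappa>) borel (\<lambda>p. (1/2) *\<^sub>R fst p + (1/2) *\<^sub>R snd p)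
      = P \<bind> (\<lambda>i. distr (\<kappa> i) borel (\<lambda>p. (1/2) *\<^sub>R fst p + (1/2) *\<^sub>R snd p))"
    by (rule distr_bind[OF measurable_kernel_UNIV[of P \<kappa>, OF P(2) k] prob_space.not_empty[OF P(1)] m])
  also have "(\<lambda>i. distr (\<kappa> i) borel (\<lambda>p. (1/2) *\<^sub>R fst p + (1/2) *\<^sub>R snd p)) = (\<lambda>i. iid_midpoint (\<rho> i))"
  proof
    fix i
    have [measurable]: "fst \<in> borel_measurable (\<rho> i \<Otimes>\<^sub>M \<rho> i)" "snd \<in> borel_measurable (\<rho> i \<Otimes>\<^sub>M \<rho> i)"
      using \<rho>(2)[of i] by (auto cong: measurable_cong_sets intro!: measurable_fst'' measurable_snd'')
    show "distr (\<kappa> i) borel (\<lambda>p. (1/2) *\<^sub>R fst p + (1/2) *\<^sub>R snd p) = iid_midpoint (\<rho> i)"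
      unfolding \<kappa>_def iid_midpoint_def
      using measurable_Pair_borel[of fst "\<rho> i \<Otimes>\<^sub>M \<rho> i" snd] by (subst distr_distr) (auto simp: comp_def)
  qed
  finally have eq: "distr (P \<bind> \<kappa>) borel (\<lambda>p. (1/2) *\<^sub>R fst p + (1/2) *\<^sub>R snd p)
      = P \<bind> (\<lambda>i. iid_midpoint (\<rho> i))" .
  have "\<forall>t\<in>{0..1}. G (distr (P \<bind> \<kappa>) borel (\<lambda>p. (1 - t) *\<^sub>R fst p + t *\<^sub>R snd p))
      \<le> ereal (1 - t) * G (P \<bind> \<rho>) + ereal t * G (P \<bind> \<rho>)"
    using G P2 bind_in_couplings[of P \<kappa> \<rho> \<rho>, OF P \<kappa>] unfolding convex_along_plans_def by blast
  then have "G (distr (P \<bind> \<kappa>) borel (\<lambda>p. (1 - 1/2) *\<^sub>R fst p + (1/2) *\<^sub>R snd p))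
      \<le> ereal (1 - 1/2) * G (P \<bind> \<rho>) + ereal (1/2) * G (P \<bind> \<rho>)"
    by (rule bspec) auto
  then show ?thesis
    using eq ereal_half_plus_half by simp
qed

text \<open>\<open>r\<close> and \<open>L\<close> are witnesses of the local Lipschitz property.
  They are fixed once because all later smallness conditions are measured against
  \<open>r\<close>.\<close>

locale convex_Lipschitz_functional =
  fixes G :: "'a::euclidean_space measure \<Rightarrow> ereal" and \<mu> :: "'a measure" and r L :: real
  assumes conv: "convex_along_plans G"
    and \<mu>: "\<mu> \<in> P2"
    and r: "0 < r"
    and L: "0 \<le> L"
    and not_MInf: "\<nu> \<in> P2 \<Longrightarrow> G \<nu> \<noteq> -\<infinity>"
    and fin: "\<nu> \<in> P2 \<Longrightarrow> W2 \<mu> \<nu> < r \<Longrightarrow> \<bar>G \<nu>\<bar> \<noteq> \<infinity>"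
    and lip: "\<nu> \<in> P2 \<Longrightarrow> \<nu>' \<in> P2 \<Longrightarrow> W2 \<mu> \<nu> < r \<Longrightarrow> W2 \<mu> \<nu>' < r \<Longrightarrow>
      \<bar>G \<nu> - G \<nu>'\<bar> \<le> ereal (L * W2 \<nu> \<nu>')"
begin

text \<open>Two additive inequalities in place of an absolute value keep subtraction in
  \<open>ereal\<close> out of the later estimates.\<close>

lemma Lipschitz_le:
  assumes "\<nu> \<in> P2" "\<nu>' \<in> P2" "W2 \<mu> \<nu> < r" "W2 \<mu> \<nu>' < r" "W2 \<nu> \<nu>' \<le> d"
  shows "G \<nu> \<le> G \<nu>' + ereal (L * d)" "G \<nu>' \<le> G \<nu> + ereal (L * d)"
proof -
  obtain a b where ab: "G \<nu> = ereal a" "G \<nu>' = ereal b"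
    using fin assms by (metis ereal_infinity_cases abs_ereal.simps(2,3) ereal_cases)
  have "\<bar>a - b\<bar> \<le> L * W2 \<nu> \<nu>'" using lip[OF assms(1-4)] ab by simp
  also have "\<dots> \<le> L * d" using assms(5) L by (rule mult_left_mono)
  finally show "G \<nu> \<le> G \<nu>' + ereal (L * d)" "G \<nu>' \<le> G \<nu> + ereal (L * d)"
    using ab by auto
qed

text \<open>Iterating the midpoint operation in every cell does not increase \<open>G\<close> and contracts each
  cell law to its mean. The distance of the iterates to \<open>\<mu>\<close> is bounded by an explicit coupling:
  the triangle inequality for \<open>W2\<close> would require gluing of couplings.\<close>

lemma cell_mean_le:
  assumes M: "prob_space M" and S: "simple_function M S"
    and Z: "square_integrable M Z" and X: "square_integrable M X" "distr M borel X = \<mu>"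
    and near: "2 * (\<integral>\<omega>. (norm (X \<omega> - cell_mean M S Z (S \<omega>)))\<^sup>2 \<partial>M) < r\<^sup>2"
  shows "G (distr M borel (\<lambda>\<omega>. cell_mean M S Z (S \<omega>))) \<le> G (distr M borel Z)"
proof -
  interpret prob_space M by fact
  let ?c = "cell_mean M S Z"
  define P where "P = distr M (count_space UNIV) S"
  note Sm = measurable_simple_function[OF S]
  have P: "prob_space P" "sets P = UNIV" using prob_space_distr[OF Sm] by (auto simp: P_def)
  interpret P: prob_space P by fact
  \<comment> \<open>\<open>\<rho> m i\<close> is the law of the average of 2^m independent copies of
    \<open>Z\<close> conditioned on cell i.\<close>
  define \<rho> where "\<rho> = (\<lambda>m i. (iid_midpoint ^^ m) (distr (cell_law M S i) borel Z))"
  \<comment> \<open>The sum of the variances bounds each of them, so one constant serves all of the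
    finitely many cells that occur.\<close>
  define V where "V = (\<Sum>i\<in>S ` space M. \<integral>\<omega>. (norm (Z \<omega> - ?c i))\<^sup>2 \<partial>cell_law M S i)"
  have Zm [measurable]: "Z \<in> borel_measurable M" using Z by (simp add: square_integrable_def)
  have V0: "0 \<le> V" unfolding V_def by (intro sum_nonneg) auto
  have hmv: "has_mean_variance (\<rho> m i) (?c i) ((\<integral>\<omega>. (norm (Z \<omega> - ?c i))\<^sup>2 \<partial>cell_law M S i) / 2 ^ m)" for m i
    unfolding \<rho>_def
  proof (rule has_mean_variance_funpow_iid_midpoint)
    interpret C: prob_space "cell_law M S i" by (rule prob_space_cell_law)
    have "square_integrable (cell_law M S i) Z" by (rule square_integrable_cell_law[OF S Z])
    then show "has_mean_variance (distr (cell_law M S i) borel Z) (?c i) (\<integral>\<omega>. (norm (Z \<omega> - ?c i))\<^sup>2 \<partial>cell_law M S i)"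
      by (simp add: has_mean_variance_def C.prob_space_distr square_integrable_distr integral_distr cell_mean_def)
  qed
  have \<rho>: "prob_space (\<rho> m i)" "sets (\<rho> m i) = sets borel" for m i
    using hmv[of m i] by (auto simp: has_mean_variance_def)
  have cost: "(\<integral>\<^sup>+z. ennreal ((norm (u - z))\<^sup>2) \<partial>\<rho> m i) \<le> ennreal (2 * (norm (u - ?c i))\<^sup>2 + 2 * (V / 2 ^ m))"
    if "i \<in> S ` space M" for u m i
  proof -
    have "(\<integral>\<omega>. (norm (Z \<omega> - ?c i))\<^sup>2 \<partial>cell_law M S i) \<le> V"
      unfolding V_def using that S by (intro member_le_sum) (auto simp: simple_function_def)
    then show ?thesis
      by (intro order_trans[OF has_mean_variance_nn_integral_le[OF hmv]] ennreal_leI)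
        (simp add: divide_right_mono)
  qed
  have fin_range: "finite (S ` space M)" using S by (simp add: simple_function_def)
  have in_P2: "P \<bind> \<rho> m \<in> P2" for m
  proof -
    have m: "\<rho> m \<in> P \<rightarrow>\<^sub>M subprob_algebra borel" by (rule measurable_kernel_UNIV) (simp_all add: P \<rho>)
    have nn: "(\<integral>\<^sup>+z. ennreal ((norm z)\<^sup>2) \<partial>(P \<bind> \<rho> m)) = (\<integral>\<^sup>+i. \<integral>\<^sup>+z. ennreal ((norm z)\<^sup>2) \<partial>\<rho> m i \<partial>P)"
      by (rule nn_integral_bind[OF _ m]) simp
    also have "\<dots> = (\<integral>\<^sup>+\<omega>. \<integral>\<^sup>+z. ennreal ((norm z)\<^sup>2) \<partial>\<rho> m (S \<omega>) \<partial>M)"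
      unfolding P_def using Sm by (simp add: nn_integral_distr)
    also have "\<dots> \<le> (\<integral>\<^sup>+\<omega>. ennreal (2 * (norm (?c (S \<omega>)))\<^sup>2 + 2 * (V / 2 ^ m)) \<partial>M)"
      using cost[of _ _ 0] by (intro nn_integral_mono) auto
    also have "\<dots> < \<infinity>"
      using square_integrable_cells[OF M S, of ?c]
      by (subst nn_integral_eq_integral) (auto simp: square_integrable_def V0)
    finally show ?thesis
      using prob_space_bind_UNIV[of P "\<rho> m", OF P \<rho>]
      by (auto simp: P2_def integrable_iff_bounded cong: measurable_cong_sets)
  qed
  \<comment> \<open>The plan draws \<omega> and, conditionally on its label, an independent point of
    \<open>\<rho> m (S \<omega>)\<close>. The bound is used with \<open>U = X\<close> to stay near
    \<mu>, and with the cell mean as \<open>U\<close> to get convergence.\<close>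
  have W: "W2 (distr M borel U) (P \<bind> \<rho> m) \<le> sqrt (2 * (\<integral>\<omega>. (norm (U \<omega> - ?c (S \<omega>)))\<^sup>2 \<partial>M) + 2 * (V / 2 ^ m))"
    (is "_ \<le> sqrt ?b") if U: "square_integrable M U" for U m
  proof -
    have Um[measurable]: "U \<in> borel_measurable M" using U by (simp add: square_integrable_def)
    define \<kappa> where "\<kappa> = (\<lambda>i. distr (cell_law M S i \<Otimes>\<^sub>M \<rho> m i) borel (\<lambda>p. (U (fst p), snd p)))"
    have \<kappa>: "\<kappa> i \<in> couplings (distr (cell_law M S i) borel U) (\<rho> m i)" for i
      unfolding \<kappa>_def by (rule distr_pair_in_couplings) (auto simp: prob_space_cell_law \<rho>)
    have k: "prob_space (\<kappa> i)" "sets (\<kappa> i) = sets borel" for i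
      using \<kappa>[of i] by (auto simp: couplings_def)
    have cm: "cell_law M S \<in> P \<rightarrow>\<^sub>M subprob_algebra M"
      by (rule measurable_kernel_UNIV) (simp_all add: P prob_space_cell_law)
    have "P \<bind> (\<lambda>i. distr (cell_law M S i) borel U) = distr (P \<bind> cell_law M S) borel U"
      by (rule distr_bind[symmetric, OF cm P.not_empty Um])
    also have "P \<bind> cell_law M S = M" unfolding P_def by (rule bind_cell_law[OF S])
    finally have coup: "P \<bind> \<kappa> \<in> couplings (distr M borel U) (P \<bind> \<rho> m)"
      using bind_in_couplings[of P \<kappa> "\<lambda>i. distr (cell_law M S i) borel U" "\<rho> m", OF P \<kappa>] by simp
    have gm: "(\<lambda>p. ennreal ((norm (fst p - snd p))\<^sup>2)) \<in> borel_measurable (borel :: ('a \<times> 'a) measure)"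
      by measurable
    have km: "\<kappa> \<in> P \<rightarrow>\<^sub>M subprob_algebra borel" by (rule measurable_kernel_UNIV) (simp_all add: P k)
    have "(\<integral>\<^sup>+p. ennreal ((norm (fst p - snd p))\<^sup>2) \<partial>(P \<bind> \<kappa>))
        = (\<integral>\<^sup>+i. \<integral>\<^sup>+p. ennreal ((norm (fst p - snd p))\<^sup>2) \<partial>\<kappa> i \<partial>P)"
      by (rule nn_integral_bind[OF gm km])
    also have "\<dots> = (\<integral>\<^sup>+i. \<integral>\<^sup>+\<omega>. \<integral>\<^sup>+z. ennreal ((norm (U \<omega> - z))\<^sup>2) \<partial>\<rho> m i \<partial>cell_law M S i \<partial>P)"
    proof (intro nn_integral_cong)
      fix i
      interpret R: prob_space "\<rho> m i" by (rule \<rho>)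
      have [measurable_cong]: "sets (\<rho> m i) = sets borel" by (rule \<rho>)
      have Up: "(\<lambda>p. (U (fst p), snd p)) \<in> cell_law M S i \<Otimes>\<^sub>M \<rho> m i \<rightarrow>\<^sub>M borel"
        by (rule measurable_Pair_borel) simp_all
      have "(\<integral>\<^sup>+p. ennreal ((norm (fst p - snd p))\<^sup>2) \<partial>\<kappa> i)
          = (\<integral>\<^sup>+p. ennreal ((norm (U (fst p) - snd p))\<^sup>2) \<partial>(cell_law M S i \<Otimes>\<^sub>M \<rho> m i))"
        unfolding \<kappa>_def using nn_integral_distr[OF Up, of "\<lambda>p. ennreal ((norm (fst p - snd p))\<^sup>2)"] gm by simp
      also have "\<dots> = (\<integral>\<^sup>+\<omega>. \<integral>\<^sup>+z. ennreal ((norm (U \<omega> - z))\<^sup>2) \<partial>\<rho> m i \<partial>cell_law M S i)"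
        using R.nn_integral_fst[of "\<lambda>p. ennreal ((norm (U (fst p) - snd p))\<^sup>2)" "cell_law M S i"] by simp
      finally show "(\<integral>\<^sup>+p. ennreal ((norm (fst p - snd p))\<^sup>2) \<partial>\<kappa> i)
          = (\<integral>\<^sup>+\<omega>. \<integral>\<^sup>+z. ennreal ((norm (U \<omega> - z))\<^sup>2) \<partial>\<rho> m i \<partial>cell_law M S i)" .
    qed
    also have "\<dots> = (\<integral>\<^sup>+\<omega>. \<integral>\<^sup>+z. ennreal ((norm (U \<omega> - z))\<^sup>2) \<partial>\<rho> m (S \<omega>) \<partial>M)"
      unfolding P_def
    proof (rule nn_integral_cells_cell_law[OF S])
      fix i
      interpret R: prob_space "\<rho> m i" by (rule \<rho>)
      have [measurable_cong]: "sets (\<rho> m i) = sets borel" by (rule \<rho>)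
      show "(\<lambda>\<omega>. \<integral>\<^sup>+z. ennreal ((norm (U \<omega> - z))\<^sup>2) \<partial>\<rho> m i) \<in> borel_measurable M"
        by measurable
    qed
    also have "\<dots> \<le> (\<integral>\<^sup>+\<omega>. ennreal (2 * (norm (U \<omega> - ?c (S \<omega>)))\<^sup>2 + 2 * (V / 2 ^ m)) \<partial>M)"
      using cost by (intro nn_integral_mono) auto
    also have "\<dots> = ennreal ?b"
      using square_integrable_diff[OF U square_integrable_cells[OF M S, of ?c]]
      by (subst nn_integral_eq_integral) (auto simp: square_integrable_def V0 prob_space)
    finally show ?thesis
      using V0 by (intro W2_le_nn_integral[OF coup]) auto
  qed
  let ?\<sigma> = "distr M borel (\<lambda>\<omega>. ?c (S \<omega>))"
  have cS: "square_integrable M (\<lambda>\<omega>. ?c (S \<omega>))" by (rule square_integrable_cells[OF M S])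
  have \<sigma>: "?\<sigma> \<in> P2" by (rule distr_in_P2[OF M cS])
  \<comment> \<open>Descent uses convexity alone, wherever the early iterates lie; the Lipschitz
    bound only compares late iterates with their limit.\<close>
  have desc: "G (P \<bind> \<rho> m) \<le> G (distr M borel Z)" for m
  proof (induction m)
    case 0
    have cm: "cell_law M S \<in> P \<rightarrow>\<^sub>M subprob_algebra M"
      by (rule measurable_kernel_UNIV) (simp_all add: P prob_space_cell_law)
    have "P \<bind> \<rho> 0 = distr (P \<bind> cell_law M S) borel Z"
      using distr_bind[OF cm P.not_empty Zm] by (simp add: \<rho>_def)
    also have "P \<bind> cell_law M S = M" unfolding P_def by (rule bind_cell_law[OF S])
    finally show ?case by simp
  next
    case (Suc m)
    have "G (P \<bind> \<rho> (Suc m)) \<le> G (P \<bind> \<rho> m)"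
      using convex_along_plans_iid_midpoint[OF conv P \<rho> in_P2, of m] by (simp add: \<rho>_def)
    then show ?case using Suc by simp
  qed
  have lim: "(\<lambda>m. 2 * a + 2 * (V / 2 ^ m)) \<longlonglongrightarrow> 2 * a" for a
    using tendsto_add[OF tendsto_const tendsto_mult[OF tendsto_const LIMSEQ_divide_realpow_zero[of 2 V]], of "2 * a" 2] by simp
  have near0: "W2 \<mu> ?\<sigma> < r"
  proof -
    have "W2 (distr M borel X) ?\<sigma> \<le> sqrt (\<integral>\<omega>. (norm (X \<omega> - ?c (S \<omega>)))\<^sup>2 \<partial>M)"
      using X(1) cS by (intro W2_distr_le[OF M]) (auto simp: square_integrable_def)
    also have "\<dots> \<le> sqrt (2 * (\<integral>\<omega>. (norm (X \<omega> - ?c (S \<omega>)))\<^sup>2 \<partial>M))" by simp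
    also have "\<dots> < r" using near r real_less_lsqrt by (simp add: real_sqrt_less_iff real_less_lsqrt)
    finally show ?thesis using X(2) by simp
  qed
  have ev1: "eventually (\<lambda>m. W2 \<mu> (P \<bind> \<rho> m) < r) sequentially"
  proof -
    have "eventually (\<lambda>m. 2 * (\<integral>\<omega>. (norm (X \<omega> - ?c (S \<omega>)))\<^sup>2 \<partial>M) + 2 * (V / 2 ^ m) < r\<^sup>2) sequentially"
      by (rule order_tendstoD(2)[OF lim near])
    then show ?thesis
    proof eventually_elim
      case (elim m)
      then have "sqrt (2 * (\<integral>\<omega>. (norm (X \<omega> - ?c (S \<omega>)))\<^sup>2 \<partial>M) + 2 * (V / 2 ^ m)) < r"
        using r by (intro real_less_lsqrt) auto
      then show ?case using W[OF X(1), of m] X(2) by simp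
    qed
  qed
  have "G ?\<sigma> \<le> G (distr M borel Z) + ereal \<delta>" if "0 < \<delta>" for \<delta>
  proof -
    \<comment> \<open>The denominator \<open>L + 1\<close> covers the case L = 0.\<close>
    define d where "d = \<delta> / (L + 1)"
    have d: "0 < d" "L * d \<le> \<delta>" using L that by (auto simp: d_def field_simps)
    have "eventually (\<lambda>m. 2 * 0 + 2 * (V / 2 ^ m) < d\<^sup>2) sequentially"
      by (rule order_tendstoD(2)[OF lim]) (use d in simp)
    with ev1 have "eventually (\<lambda>m. W2 \<mu> (P \<bind> \<rho> m) < r \<and> W2 ?\<sigma> (P \<bind> \<rho> m) \<le> d) sequentially"
    proof eventually_elim
      case (elim m)
      then have "sqrt (2 * 0 + 2 * (V / 2 ^ m)) \<le> d"
        using d by (intro real_le_lsqrt) (auto simp: V0)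
      then show ?case using elim W[OF cS, of m] by simp
    qed
    then obtain m where m: "W2 \<mu> (P \<bind> \<rho> m) < r" "W2 ?\<sigma> (P \<bind> \<rho> m) \<le> d"
      by (auto simp: eventually_sequentially)
    have "G ?\<sigma> \<le> G (P \<bind> \<rho> m) + ereal (L * d)"
      by (rule Lipschitz_le(1)[OF \<sigma> in_P2 near0 m])
    also have "\<dots> \<le> G (distr M borel Z) + ereal \<delta>"
      using desc d by (intro add_mono) auto
    finally show ?thesis .
  qed
  then show ?thesis
    by (rule ereal_le_epsilon2) auto
qed

end

subsection \<open>Clarke derivatives\<close>

text \<open>Linear growth is matched by the finite second moment of \<nu>.\<close>

lemma square_integrable_C1:
  assumes w: "w \<in> C1" and \<nu>: "\<nu> \<in> P2"
  shows "square_integrable \<nu> w"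
proof -
  interpret prob_space \<nu> using \<nu> by (simp add: P2_def)
  have [measurable]: "w \<in> borel_measurable \<nu>"
    using w \<nu> borel_measurable_continuous_onI[of w] by (simp add: C1_def P2_def cong: measurable_cong_sets)
  obtain B where B: "\<And>x. norm (w x) / (1 + norm x) \<le> B"
    using w by (auto simp: C1_def bdd_above_def)
  have B0: "0 \<le> B" by (rule order_trans[OF _ B[of 0]]) simp
  have "(norm (w x))\<^sup>2 \<le> B\<^sup>2 * (2 + 2 * (norm x)\<^sup>2)" for x
  proof -
    have "norm (w x) \<le> B * (1 + norm x)" using B[of x]
      by (metis add_pos_nonneg norm_ge_zero pos_divide_le_eq zero_less_one)
    from power_mono[OF this norm_ge_zero, of 2]
    have "(norm (w x))\<^sup>2 \<le> B\<^sup>2 * (1 + norm x)\<^sup>2" by (simp only: power_mult_distrib)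
    also have "(1 + norm x)\<^sup>2 \<le> 2 + 2 * (norm x)\<^sup>2"
      using norm_add_squared_le[of 1 "norm x"] by simp
    finally show ?thesis by (simp add: mult_left_mono)
  qed
  then show ?thesis
    using \<nu> by (intro square_integrable_bound[where g="\<lambda>x. B\<^sup>2 * (2 + 2 * (norm x)\<^sup>2)"]) (auto simp: P2_def)
qed

lemma bounded_continuous_in_C1:
  assumes "continuous_on UNIV w" "\<And>x. norm (w x) \<le> B"
  shows "w \<in> C1"
proof -
  have "norm (w x) / (1 + norm x) \<le> B" for x
    using assms(2)[of x] norm_ge_zero[of "w x"]
    by (intro order_trans[OF _ assms(2)[of x]] ) (simp add: divide_le_eq add_pos_nonneg algebra_simps)
  then show ?thesis
    using assms(1) by (auto simp: C1_def intro!: bdd_aboveI[of _ B])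
qed

lemma eventually_nhds_W2:
  assumes "0 < \<delta>"
  shows "eventually (\<lambda>\<nu>. \<nu> \<in> P2 \<and> W2 \<mu> \<nu> < \<delta>) (nhds_W2 \<mu>)"
  unfolding nhds_W2_def using assms
  by (intro eventually_INF1[of \<delta>]) (auto simp: eventually_principal)

text \<open>Every neighbourhood contains \<mu>, because its distance to itself is not positive. The
  upper limit can therefore be bounded from below along the constant family \<nu> = \<mu>.\<close>

lemma eventually_nhds_W2_imp_at:
  assumes "\<mu> \<in> P2" "eventually Q (nhds_W2 \<mu>)"
  shows "Q \<mu>"
proof -
  have "principal {\<mu>} \<le> nhds_W2 \<mu>"
    unfolding nhds_W2_def using assms(1) W2_refl_le[OF assms(1)]
    by (intro INF_greatest) auto
  then show ?thesis using assms(2) by (auto simp: le_filter_def eventually_principal)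
qed

lemma le_clarke_deriv:
  assumes \<mu>: "\<mu> \<in> P2"
    and le: "\<And>t. 0 < t \<Longrightarrow> l \<le> (G (distr \<mu> borel (\<lambda>x. x + t *\<^sub>R w x)) - G \<mu>) / ereal t"
  shows "l \<le> clarke_deriv G \<mu> w"
  unfolding clarke_deriv_def
proof (rule Limsup_greatest)
  fix Q assume "eventually Q (nhds_W2 \<mu> \<times>\<^sub>F at_right (0::real))"
  then obtain Pf Pg where *: "eventually Pf (nhds_W2 \<mu>)" "eventually Pg (at_right (0::real))"
    "\<And>\<nu> t. Pf \<nu> \<Longrightarrow> Pg t \<Longrightarrow> Q (\<nu>, t)"
    unfolding eventually_prod_filter by auto
  obtain b where b: "b > 0" "\<And>t. 0 < t \<Longrightarrow> t < b \<Longrightarrow> Pg t"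
    using *(2) unfolding eventually_at_right_field by auto
  have "Q (\<mu>, b / 2)" using *(3)[OF eventually_nhds_W2_imp_at[OF \<mu> *(1)] b(2)] b(1) by simp
  then show "l \<le> (SUP (\<nu>, t)\<in>Collect Q. (G (distr \<nu> borel (\<lambda>x. x + t *\<^sub>R w x)) - G \<nu>) / ereal t)"
    using le[of "b / 2"] b(1) by (intro SUP_upper2[of "(\<mu>, b / 2)"]) auto
qed

text \<open>A dictionary between maps under a marginal and maps on the plan, so that estimates about
  \<mu> and \<nu> can all be made on the single space of \<gamma>.\<close>

lemma couplings_marginals:
  fixes \<mu> \<nu> :: "'a::euclidean_space measure" and f :: "'a \<Rightarrow> 'a"
  assumes "\<gamma> \<in> couplings \<mu> \<nu>" "\<mu> \<in> P2" "\<nu> \<in> P2"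
  shows "prob_space \<gamma>" "sets \<gamma> = sets borel" 
    "f \<in> borel_measurable borel \<Longrightarrow> distr \<gamma> borel (\<lambda>p. f (fst p)) = distr \<mu> borel f"
    "f \<in> borel_measurable borel \<Longrightarrow> distr \<gamma> borel (\<lambda>p. f (snd p)) = distr \<nu> borel f"
    "f \<in> borel_measurable borel \<Longrightarrow> square_integrable \<gamma> (\<lambda>p. f (fst p)) \<longleftrightarrow> square_integrable \<mu> f"
    "f \<in> borel_measurable borel \<Longrightarrow> square_integrable \<gamma> (\<lambda>p. f (snd p)) \<longleftrightarrow> square_integrable \<nu> f"
    "square_integrable \<gamma> fst" "square_integrable \<gamma> snd"
proof -
  show p: "prob_space \<gamma>" and s: "sets \<gamma> = sets borel" using assms(1) by (auto simp: couplings_def)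
  have [measurable]: "fst \<in> borel_measurable \<gamma>" "snd \<in> borel_measurable \<gamma>"
    using measurable_fst_snd_borel[where 'a='a] s by (auto cong: measurable_cong_sets)
  have d: "distr \<gamma> borel fst = \<mu>" "distr \<gamma> borel snd = \<nu>" using assms(1) by (auto simp: couplings_def)
  show "f \<in> borel_measurable borel \<Longrightarrow> distr \<gamma> borel (\<lambda>p. f (fst p)) = distr \<mu> borel f"
    "f \<in> borel_measurable borel \<Longrightarrow> distr \<gamma> borel (\<lambda>p. f (snd p)) = distr \<nu> borel f"
    by (simp_all add: distr_distr comp_def flip: d)
  have si: "square_integrable \<gamma> (\<lambda>p. f (fst p)) \<longleftrightarrow> square_integrable \<mu> f"
    "square_integrable \<gamma> (\<lambda>p. f (snd p)) \<longleftrightarrow> square_integrable \<nu> f"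
    if "f \<in> borel_measurable borel" for f :: "'a \<Rightarrow> 'a"
    using that square_integrable_distr[of fst \<gamma> borel f] square_integrable_distr[of snd \<gamma> borel f] d by auto
  then show "f \<in> borel_measurable borel \<Longrightarrow> square_integrable \<gamma> (\<lambda>p. f (fst p)) \<longleftrightarrow> square_integrable \<mu> f"
    "f \<in> borel_measurable borel \<Longrightarrow> square_integrable \<gamma> (\<lambda>p. f (snd p)) \<longleftrightarrow> square_integrable \<nu> f"
    by blast+
  show "square_integrable \<gamma> fst" "square_integrable \<gamma> snd"
    using si[of "\<lambda>x. x"] square_integrable_id_P2 assms(2,3) by auto
qed

section \<open>Convexity along translations and the Clarke derivative\<close>

context convex_Lipschitz_functional
begin

lemma near_self: "W2 \<mu> \<mu> < r"
  using W2_refl_le[OF \<mu>] r by simp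

lemma finite_at: obtains a where "G \<mu> = ereal a"
  using fin[OF \<mu> near_self] by auto

lemma translate_in_P2:
  assumes "w \<in> C1" "\<nu> \<in> P2"
  shows "square_integrable \<nu> (\<lambda>x. x + t *\<^sub>R w x)" "distr \<nu> borel (\<lambda>x. x + t *\<^sub>R w x) \<in> P2"
proof -
  show "square_integrable \<nu> (\<lambda>x. x + t *\<^sub>R w x)"
    by (intro square_integrable_add square_integrable_scaleR square_integrable_C1 square_integrable_id_P2 assms)
  then show "distr \<nu> borel (\<lambda>x. x + t *\<^sub>R w x) \<in> P2"
    using assms(2) by (intro distr_in_P2) (auto simp: P2_def)
qed

text \<open>The point x + t w(x) lies on the segment from x to x + \<tau> w(x) with weight t/\<tau>,
  so this is convexity along the plan (id, id + \<tau> w). It expresses monotonicity of difference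
  quotients without subtraction in \<open>ereal\<close>.\<close>

lemma convex_translate:
  assumes w: "w \<in> C1" and \<nu>: "\<nu> \<in> P2" and t: "0 \<le> t" "t \<le> \<tau>" "0 < \<tau>"
  shows "G (distr \<nu> borel (\<lambda>x. x + t *\<^sub>R w x))
    \<le> ereal (1 - t / \<tau>) * G \<nu> + ereal (t / \<tau>) * G (distr \<nu> borel (\<lambda>x. x + \<tau> *\<^sub>R w x))"
proof -
  have *: "(\<lambda>x. (1 - t / \<tau>) *\<^sub>R x + (t / \<tau>) *\<^sub>R (x + \<tau> *\<^sub>R w x)) = (\<lambda>x. x + t *\<^sub>R w x)"
  proof
    fix x
    have "(1 - s) *\<^sub>R x + s *\<^sub>R (x + \<tau> *\<^sub>R w x) = x + (s * \<tau>) *\<^sub>R w x" for s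
      by (simp add: scaleR_diff_left scaleR_add_right)
    from this[of "t / \<tau>"] show "(1 - t / \<tau>) *\<^sub>R x + (t / \<tau>) *\<^sub>R (x + \<tau> *\<^sub>R w x) = x + t *\<^sub>R w x"
      using t(3) by simp
  qed
  have p: "prob_space \<nu>" and s: "sets \<nu> = sets borel" using \<nu> by (auto simp: P2_def)
  have "distr \<nu> borel (\<lambda>x. x) = \<nu>" using s by (metis distr_id2)
  then show ?thesis
    using convex_along_plans_distr[OF conv p square_integrable_id_P2[OF \<nu>] translate_in_P2(1)[OF w \<nu>], of "t / \<tau>" \<tau>] t
    by (simp add: *)
qed

text \<open>The upper limit varies the base point too. Monotonicity bounds the quotient at (\<nu>,
  t) by the one at (\<nu>, \<tau>), and for fixed \<tau> the latter depends continuously on \<nu>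
  near \<mu>: push-forward by the Lipschitz map x + \<tau> w(x) is Lipschitz for \<open>W2\<close>.
  The bound on \<open>\<tau> * B\<close> keeps the translated measures in the ball.\<close>

lemma clarke_deriv_le_difference_quotient:
  assumes B: "\<And>x. norm (w x) \<le> B" and C: "C-lipschitz_on UNIV w"
    and \<tau>: "0 < \<tau>" "\<tau> * B \<le> r / 4"
  obtains a b where "G \<mu> = ereal a" "G (distr \<mu> borel (\<lambda>x. x + \<tau> *\<^sub>R w x)) = ereal b"
    "clarke_deriv G \<mu> w \<le> ereal ((b - a) / \<tau>)"
proof -
  let ?T = "\<lambda>t \<nu>. distr \<nu> borel (\<lambda>x. x + t *\<^sub>R w x)"
  have B0: "0 \<le> B" using B[of 0] norm_ge_zero[of "w 0"] by linarith
  have C0: "0 \<le> C" using C by (rule lipschitz_on_nonneg)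
  have cont: "continuous_on UNIV w" by (rule lipschitz_on_continuous_on[OF C])
  have w: "w \<in> C1" by (rule bounded_continuous_in_C1[OF cont B])
  have wm: "w \<in> borel_measurable borel" by (rule borel_measurable_continuous_onI[OF cont])
  have near: "W2 \<mu> (?T \<tau> \<nu>) < r" "W2 (?T \<tau> \<mu>) (?T \<tau> \<nu>) \<le> (1 + \<tau> * C) * \<delta>"
    if \<nu>: "\<nu> \<in> P2" "W2 \<mu> \<nu> < \<delta>" "0 < \<delta>" "\<delta> \<le> r / 4" for \<nu> \<delta>
  proof -
    obtain \<gamma> where \<gamma>: "\<gamma> \<in> couplings \<mu> \<nu>" "(\<integral>p. (dist (fst p) (snd p))\<^sup>2 \<partial>\<gamma>) < \<delta>\<^sup>2"
      using W2_less_coupling[OF \<mu> \<nu>(1,2)] by blast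
    note cf = couplings_marginals[OF \<gamma>(1) \<mu> \<nu>(1)]
    interpret prob_space \<gamma> by (rule cf)
    let ?g = "\<lambda>x. x + \<tau> *\<^sub>R w x"
    have gm: "?g \<in> borel_measurable borel" using wm by simp
    have sd: "square_integrable \<gamma> (\<lambda>p. fst p - snd p)"
      by (rule square_integrable_diff[OF cf(7,8)])
    have dl: "(\<integral>p. (norm (fst p - snd p))\<^sup>2 \<partial>\<gamma>) \<le> \<delta>\<^sup>2" using \<gamma>(2) by (simp add: dist_norm)
    have g1: "square_integrable \<gamma> (\<lambda>p. ?g (fst p))" "square_integrable \<gamma> (\<lambda>p. ?g (snd p))"
      "square_integrable \<gamma> (\<lambda>p. \<tau> *\<^sub>R w (snd p))"
      using cf(5,6)[OF gm] cf(6)[OF wm] translate_in_P2(1)[OF w \<mu>] translate_in_P2(1)[OF w \<nu>(1)] square_integrable_C1[OF w \<nu>(1)]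
      by (auto intro: square_integrable_scaleR)
    \<comment> \<open>2 (r/4)^2 + 2 (r/4)^2 = (r/2)^2: one share for the distance from \<mu> to
      \<nu>, one for the displacement by \<tau> w.\<close>
    have "(\<integral>p. (norm (fst p - ?g (snd p)))\<^sup>2 \<partial>\<gamma>) \<le> (r / 2)\<^sup>2"
    proof -
      have "(\<integral>p. (norm (fst p - ?g (snd p)))\<^sup>2 \<partial>\<gamma>) = (\<integral>p. (norm ((fst p - snd p) + (-1) *\<^sub>R (\<tau> *\<^sub>R w (snd p))))\<^sup>2 \<partial>\<gamma>)"
        by (simp add: algebra_simps)
      also have "\<dots> \<le> 2 * (\<integral>p. (norm (fst p - snd p))\<^sup>2 \<partial>\<gamma>) + 2 * (\<integral>p. (norm ((-1) *\<^sub>R (\<tau> *\<^sub>R w (snd p))))\<^sup>2 \<partial>\<gamma>)"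
        by (intro integral_norm_add_squared_le sd square_integrable_scaleR g1)
      also have "(\<integral>p. (norm ((-1) *\<^sub>R (\<tau> *\<^sub>R w (snd p))))\<^sup>2 \<partial>\<gamma>) \<le> (\<integral>p. (r / 4)\<^sup>2 \<partial>\<gamma>)"
      proof (intro integral_mono power_mono)
        fix p
        have "norm ((-1) *\<^sub>R (\<tau> *\<^sub>R w (snd p))) \<le> \<tau> * B" using B[of "snd p"] \<tau> by simp
        then show "norm ((-1) *\<^sub>R (\<tau> *\<^sub>R w (snd p))) \<le> r / 4" using \<tau> by linarith
      qed (use g1(3) in \<open>auto simp: square_integrable_def\<close>)
      also have "(\<integral>p. (norm (fst p - snd p))\<^sup>2 \<partial>\<gamma>) \<le> (r / 4)\<^sup>2"
        using dl power_mono[OF \<nu>(4), of 2] \<nu>(3) by linarith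
      finally show ?thesis by (simp add: prob_space power2_eq_square)
    qed
    then have "W2 (distr \<gamma> borel fst) (distr \<gamma> borel (\<lambda>p. ?g (snd p))) \<le> r / 2"
      using r cf(7) g1 by (intro W2_distr_le) (auto simp: square_integrable_def prob_space_axioms)
    moreover have "distr \<gamma> borel fst = \<mu>" using \<gamma>(1) by (simp add: couplings_def)
    ultimately show "W2 \<mu> (?T \<tau> \<nu>) < r" using cf(4)[OF gm] r by simp
    have "(\<integral>p. (norm (?g (fst p) - ?g (snd p)))\<^sup>2 \<partial>\<gamma>) \<le> (\<integral>p. (1 + \<tau> * C)\<^sup>2 * (norm (fst p - snd p))\<^sup>2 \<partial>\<gamma>)"
    proof (rule integral_mono)
      fix p
      have "norm (?g (fst p) - ?g (snd p)) = norm ((fst p - snd p) + \<tau> *\<^sub>R (w (fst p) - w (snd p)))"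
        by (simp add: algebra_simps)
      also have "\<dots> \<le> norm (fst p - snd p) + \<tau> * norm (w (fst p) - w (snd p))"
        using norm_triangle_ineq[of "fst p - snd p" "\<tau> *\<^sub>R (w (fst p) - w (snd p))"] \<tau> by simp
      also have "\<dots> \<le> norm (fst p - snd p) + \<tau> * (C * norm (fst p - snd p))"
        using lipschitz_on_normD[OF C, of "fst p" "snd p"] \<tau> by simp
      finally have "norm (?g (fst p) - ?g (snd p)) \<le> (1 + \<tau> * C) * norm (fst p - snd p)"
        by (simp add: algebra_simps)
      from power_mono[OF this norm_ge_zero, of 2]
      show "(norm (?g (fst p) - ?g (snd p)))\<^sup>2 \<le> (1 + \<tau> * C)\<^sup>2 * (norm (fst p - snd p))\<^sup>2"
        by (simp only: power_mult_distrib)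
    qed (use sd square_integrable_diff[OF g1(1,2)] in \<open>auto simp: square_integrable_def\<close>)
    also have "\<dots> \<le> ((1 + \<tau> * C) * \<delta>)\<^sup>2"
      using dl by (simp add: power_mult_distrib mult_left_mono)
    finally have "W2 (distr \<gamma> borel (\<lambda>p. ?g (fst p))) (distr \<gamma> borel (\<lambda>p. ?g (snd p))) \<le> (1 + \<tau> * C) * \<delta>"
      using g1 \<tau> C0 \<nu>(3) by (intro W2_distr_le) (auto simp: square_integrable_def prob_space_axioms)
    then show "W2 (?T \<tau> \<mu>) (?T \<tau> \<nu>) \<le> (1 + \<tau> * C) * \<delta>" using cf(3,4)[OF gm] by simp
  qed
  obtain a where a: "G \<mu> = ereal a" by (rule finite_at)
  have Tn: "W2 \<mu> (?T \<tau> \<mu>) < r"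
    by (rule near(1)[of \<mu> "r / 4"]) (use \<mu> r W2_refl_le[OF \<mu>] in auto)
  obtain b where b: "G (?T \<tau> \<mu>) = ereal b"
    using fin[OF translate_in_P2(2)[OF w \<mu>] Tn] by auto
  \<comment> \<open>The error consists of L \<delta> for replacing G \<nu> by G \<mu> and L (1 +
    \<tau> C) \<delta> for the measures translated by \<tau> w.\<close>
  have bound: "clarke_deriv G \<mu> w \<le> ereal ((b - a + L * (2 + \<tau> * C) * \<delta>) / \<tau>)"
    if \<delta>: "0 < \<delta>" "\<delta> \<le> r / 4" for \<delta>
    unfolding clarke_deriv_def
  proof (rule Limsup_bounded)
    have "eventually (\<lambda>t. 0 < t \<and> t < \<tau>) (at_right (0::real))"
      using \<tau>(1) unfolding eventually_at_right_field by auto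
    then have "eventually (\<lambda>x. (fst x \<in> P2 \<and> W2 \<mu> (fst x) < \<delta>) \<and> (0 < snd x \<and> snd x < \<tau>)) (nhds_W2 \<mu> \<times>\<^sub>F at_right (0::real))"
      by (rule eventually_prodI[OF eventually_nhds_W2[OF \<delta>(1)]])
    then show "eventually (\<lambda>x. (case x of (\<nu>, t) \<Rightarrow> (G (?T t \<nu>) - G \<nu>) / ereal t)
        \<le> ereal ((b - a + L * (2 + \<tau> * C) * \<delta>) / \<tau>)) (nhds_W2 \<mu> \<times>\<^sub>F at_right 0)"
    proof eventually_elim
      case (elim x)
      obtain \<nu> t where x: "x = (\<nu>, t)" by (cases x)
      have \<nu>: "\<nu> \<in> P2" "W2 \<mu> \<nu> < \<delta>" and t: "0 < t" "t < \<tau>" using elim x by auto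
      have \<nu>r: "W2 \<mu> \<nu> < r" using \<nu> \<delta> r by linarith
      obtain a' where a': "G \<nu> = ereal a'" using fin[OF \<nu>(1) \<nu>r] by auto
      note T\<nu> = translate_in_P2(2)[OF w \<nu>(1)] and T\<mu> = translate_in_P2(2)[OF w \<mu>]
      obtain b' where b': "G (?T \<tau> \<nu>) = ereal b'" using fin[OF T\<nu> near(1)[OF \<nu> \<delta>]] by auto
      have 1: "a \<le> a' + L * \<delta>"
        using Lipschitz_le(1)[OF \<mu> \<nu>(1) near_self \<nu>r, of \<delta>] \<nu>(2) a a' by simp
      have 2: "b' \<le> b + L * ((1 + \<tau> * C) * \<delta>)"
        using Lipschitz_le(2)[OF T\<mu> T\<nu> Tn near(1)[OF \<nu> \<delta>] near(2)[OF \<nu> \<delta>]] b b' by simp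
      define s where "s = t / \<tau>"
      have 3: "G (?T t \<nu>) \<le> ereal ((1 - s) * a' + s * b')"
        using convex_translate[OF w \<nu>(1), of t \<tau>] t a' b' by (simp add: s_def)
      \<comment> \<open>Finiteness at the intermediate step t: convexity bounds the value from
        above, and -\<infinity> is excluded on \<open>P2\<close>.\<close>
      then obtain e where e: "G (?T t \<nu>) = ereal e"
        using not_MInf[OF T\<nu>, of t] by (cases "G (?T t \<nu>)") auto
      have "e - a' \<le> s * (b' - a')" using 3 e by (simp add: algebra_simps)
      then have "(e - a') / t \<le> (b' - a') / \<tau>" using t by (simp add: s_def field_simps)
      also have "\<dots> \<le> (b - a + L * (2 + \<tau> * C) * \<delta>) / \<tau>"
        using 1 2 \<tau>(1) by (intro divide_right_mono) (auto simp: algebra_simps)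
      finally show ?case using x e a' t by simp
    qed
  qed
  have "clarke_deriv G \<mu> w \<le> ereal ((b - a) / \<tau>)"
  proof (rule ereal_le_epsilon2)
    fix \<eta> :: real assume \<eta>: "0 < \<eta>"
    define K where "K = L * (2 + \<tau> * C) / \<tau>"
    have K: "0 \<le> K" using L C0 \<tau>(1) by (simp add: K_def)
    define \<delta> where "\<delta> = min (r / 4) (\<eta> / (K + 1))"
    have \<delta>: "0 < \<delta>" "\<delta> \<le> r / 4"
      using r \<eta> K unfolding \<delta>_def by (simp, intro min.cobounded1)
    have "\<delta> \<le> \<eta> / (K + 1)" by (simp add: \<delta>_def)
    then have "K * \<delta> \<le> (K + 1) * (\<eta> / (K + 1))"
      using K \<delta>(1) by (intro mult_mono) auto
    then have "K * \<delta> \<le> \<eta>" using K by simp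
    moreover have "(b - a + L * (2 + \<tau> * C) * \<delta>) / \<tau> = (b - a) / \<tau> + K * \<delta>"
      by (simp add: K_def add_divide_distrib)
    ultimately have "ereal ((b - a + L * (2 + \<tau> * C) * \<delta>) / \<tau>) \<le> ereal ((b - a) / \<tau>) + ereal \<eta>"
      by simp
    then show "clarke_deriv G \<mu> w \<le> ereal ((b - a) / \<tau>) + ereal \<eta>"
      using bound[OF \<delta>] by (rule order_trans[rotated])
  qed
  then show ?thesis using that a b by blast
qed

text \<open>By monotonicity of difference quotients the step \<open>T\<close> may be chosen independently of
  \<open>w\<close>.\<close>

lemma clarke_subdiff_imp_translate_le:
  assumes \<Xi>: "\<Xi> \<in> clarke_subdiff G \<mu>" and B: "\<And>x. norm (w x) \<le> B" and C: "C-lipschitz_on UNIV w"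
    and T: "0 < T"
  shows "G \<mu> + ereal (T * inner_L2 \<mu> \<Xi> w) \<le> G (distr \<mu> borel (\<lambda>x. x + T *\<^sub>R w x))"
proof -
  have B0: "0 \<le> B" using B[of 0] norm_ge_zero[of "w 0"] by linarith
  \<comment> \<open>Small enough for the difference quotient bound, which depends on
    \<open>B\<close>; the summand 1 prevents division by zero.\<close>
  define \<tau> where "\<tau> = min T (r / (4 * (B + 1)))"
  have \<tau>: "0 < \<tau>" "\<tau> \<le> T" using T r B0 by (auto simp: \<tau>_def)
  have "\<tau> * B \<le> r / (4 * (B + 1)) * (B + 1)"
    using r B0 \<tau> by (intro mult_mono) (auto simp: \<tau>_def)
  also have "\<dots> = r / 4" using B0 by (simp add: divide_simps)
  finally have \<tau>B: "\<tau> * B \<le> r / 4" .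
  obtain a b where ab: "G \<mu> = ereal a" "G (distr \<mu> borel (\<lambda>x. x + \<tau> *\<^sub>R w x)) = ereal b"
    "clarke_deriv G \<mu> w \<le> ereal ((b - a) / \<tau>)"
    by (rule clarke_deriv_le_difference_quotient[OF B C \<tau>(1) \<tau>B])
  have w: "w \<in> C1" by (rule bounded_continuous_in_C1[OF lipschitz_on_continuous_on[OF C] B])
  then have "ereal (inner_L2 \<mu> \<Xi> w) \<le> clarke_deriv G \<mu> w" using \<Xi> by (simp add: clarke_subdiff_def)
  from order_trans[OF this ab(3)] have i: "\<tau> * inner_L2 \<mu> \<Xi> w \<le> b - a"
    using \<tau>(1) by (simp add: field_simps)
  note c = convex_translate[OF w \<mu>, of \<tau> T]
  show ?thesis
  proof (cases "G (distr \<mu> borel (\<lambda>x. x + T *\<^sub>R w x))")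
    case (real g)
    define s where "s = \<tau> / T"
    have "b \<le> (1 - s) * a + s * g" using c \<tau> T ab real by (simp add: s_def)
    with i have "\<tau> * inner_L2 \<mu> \<Xi> w \<le> s * (g - a)" by (simp add: algebra_simps)
    then have "\<tau> * (T * inner_L2 \<mu> \<Xi> w) \<le> \<tau> * (g - a)" using T by (simp add: s_def field_simps)
    then show ?thesis using \<tau>(1) ab real by simp
  next
    case PInf
    then show ?thesis by simp
  next
    case MInf
    then show ?thesis using not_MInf[OF translate_in_P2(2)[OF w \<mu>]] by simp
  qed
qed

lemma subgradient_imp_clarke_subdiff:
  assumes \<Xi>: "\<Xi> \<in> L2 \<mu>"
    and sub: "\<And>\<nu> \<gamma>. \<nu> \<in> P2 \<Longrightarrow> \<gamma> \<in> couplings \<mu> \<nu> \<Longrightarrow>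
      G \<mu> + ereal (\<integral>p. \<Xi> (fst p) \<bullet> (snd p - fst p) \<partial>\<gamma>) \<le> G \<nu>"
  shows "\<Xi> \<in> clarke_subdiff G \<mu>"
  unfolding clarke_subdiff_def
proof (intro CollectI conjI \<Xi> ballI le_clarke_deriv[OF \<mu>])
  fix w :: "'a \<Rightarrow> 'a" and t :: real assume w: "w \<in> C1" and t: "0 < t"
  let ?g = "\<lambda>x. x + t *\<^sub>R w x"
  have s: "sets \<mu> = sets borel" and p: "prob_space \<mu>" using \<mu> by (auto simp: P2_def)
  have gm: "?g \<in> borel_measurable \<mu>" using translate_in_P2(1)[OF w \<mu>] by (simp add: square_integrable_def)
  have \<Xi>m: "\<Xi> \<in> borel_measurable borel"
    using \<Xi> s by (auto simp: L2_def cong: measurable_cong_sets)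
  have im: "(\<lambda>x. x) \<in> borel_measurable \<mu>" using s by (auto cong: measurable_cong_sets)
  have "distr \<mu> borel (\<lambda>x. x) = \<mu>" using s by (metis distr_id2)
  then have \<gamma>: "distr \<mu> borel (\<lambda>x. (x, ?g x)) \<in> couplings \<mu> (distr \<mu> borel ?g)"
    using distr_Pair_in_couplings[OF p im gm] by simp
  have pm: "(\<lambda>x. (x, ?g x)) \<in> \<mu> \<rightarrow>\<^sub>M borel" by (rule measurable_Pair_borel[OF im gm])
  have "(\<integral>p. \<Xi> (fst p) \<bullet> (snd p - fst p) \<partial>distr \<mu> borel (\<lambda>x. (x, ?g x))) = (\<integral>x. \<Xi> x \<bullet> (t *\<^sub>R w x) \<partial>\<mu>)"
    using \<Xi>m by (subst integral_distr[OF pm]) auto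
  also have "\<dots> = t * inner_L2 \<mu> \<Xi> w" by (simp add: inner_L2_def)
  finally have *: "G \<mu> + ereal (t * inner_L2 \<mu> \<Xi> w) \<le> G (distr \<mu> borel ?g)"
    using sub[OF translate_in_P2(2)[OF w \<mu>] \<gamma>] by simp
  obtain a where a: "G \<mu> = ereal a" by (rule finite_at)
  \<comment> \<open>If \<open>G\<close> is +\<infinity> at the translated measure, so is the
    quotient; -\<infinity> contradicts \<open>*\<close>.\<close>
  show "ereal (inner_L2 \<mu> \<Xi> w) \<le> (G (distr \<mu> borel ?g) - G \<mu>) / ereal t"
    using * a t by (cases "G (distr \<mu> borel ?g)") (auto simp: field_simps)
qed

end

subsection \<open>Approximation by simple and by Lipschitz maps\<close>

lemma square_integrable_simple_approx:
  assumes f: "square_integrable M f" and \<epsilon>: "0 < \<epsilon>"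
  obtains s where "simple_function M s" "(\<integral>x. (norm (f x - s x))\<^sup>2 \<partial>M) \<le> \<epsilon>\<^sup>2"
proof -
  have fm[measurable]: "f \<in> borel_measurable M" and fi: "integrable M (\<lambda>x. (norm (f x))\<^sup>2)"
    using f by (auto simp: square_integrable_def)
  obtain F where F: "\<And>i. simple_function M (F i)" "\<And>x. x \<in> space M \<Longrightarrow> (\<lambda>i. F i x) \<longlonglongrightarrow> f x"
    "\<And>i x. x \<in> space M \<Longrightarrow> dist (F i x) 0 \<le> 2 * dist (f x) 0"
    using borel_measurable_implies_sequence_metric[OF fm, of 0] by blast
  have [measurable]: "F i \<in> borel_measurable M" for i by (rule borel_measurable_simple_function[OF F(1)])
  have "(\<lambda>i. \<integral>x. (norm (f x - F i x))\<^sup>2 \<partial>M) \<longlonglongrightarrow> (\<integral>x. 0 \<partial>M)"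
  \<comment> \<open>Since |F| \<le> 2 |f|, one has |f - F|^2 \<le> 2 |f|^2 + 2 (2 |f|)^2 = 10
    |f|^2.\<close>
  proof (rule integral_dominated_convergence[where w="\<lambda>x. 10 * (norm (f x))\<^sup>2"])
    show "integrable M (\<lambda>x. 10 * (norm (f x))\<^sup>2)" using fi by simp
    show "AE x in M. (\<lambda>i. (norm (f x - F i x))\<^sup>2) \<longlonglongrightarrow> 0"
    proof (rule AE_I2)
      fix x assume "x \<in> space M"
      then have "(\<lambda>i. (norm (f x - F i x))\<^sup>2) \<longlonglongrightarrow> (norm (f x - f x))\<^sup>2"
        by (intro tendsto_intros F(2))
      then show "(\<lambda>i. (norm (f x - F i x))\<^sup>2) \<longlonglongrightarrow> 0" by simp
    qed
    show "AE x in M. norm ((norm (f x - F i x))\<^sup>2) \<le> 10 * (norm (f x))\<^sup>2" for i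
    proof (rule AE_I2)
      fix x assume "x \<in> space M"
      then have "(norm (F i x))\<^sup>2 \<le> (2 * norm (f x))\<^sup>2" using F(3)[of x i] by (intro power_mono) auto
      then show "norm ((norm (f x - F i x))\<^sup>2) \<le> 10 * (norm (f x))\<^sup>2"
        using norm_add_squared_le[of "f x" "- F i x"] by (simp add: power_mult_distrib)
    qed
  qed auto
  then have "eventually (\<lambda>i. (\<integral>x. (norm (f x - F i x))\<^sup>2 \<partial>M) < \<epsilon>\<^sup>2) sequentially"
    using \<epsilon> by (intro order_tendstoD(2)[where a="\<epsilon>\<^sup>2"]) auto
  then obtain i where "(\<integral>x. (norm (f x - F i x))\<^sup>2 \<partial>M) < \<epsilon>\<^sup>2"
    by (auto simp: eventually_sequentially)
  then show ?thesis using that[OF F(1)[of i]] by simp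
qed

text \<open>Inner regularity replaces A by a compact K, and the tents max(0, 1 - n dist(x, K)) are
  n-Lipschitz and decrease to the indicator of K. Each of the two errors gets \<epsilon>/4, since
  squaring a sum costs a factor 2.\<close>

lemma Lipschitz_indicator_approx:
  fixes M :: "'a::euclidean_space measure"
  assumes M: "finite_measure M" and s: "sets M = sets borel" and A: "A \<in> sets borel" and \<epsilon>: "0 < \<epsilon>"
  obtains f :: "'a \<Rightarrow> real" and C where "\<And>x. \<bar>f x\<bar> \<le> 1" "C-lipschitz_on UNIV f"
    "(\<integral>x. (f x - indicator A x)\<^sup>2 \<partial>M) < \<epsilon>"
proof -
  interpret finite_measure M by fact
  note [measurable_cong] = s
  note [measurable] = A
  have fin: "emeasure M (space M) \<noteq> \<infinity>" by simp
  have "\<exists>K. K \<subseteq> A \<and> compact K \<and> measure M A - \<epsilon> / 4 < measure M K"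
  proof (rule ccontr)
    assume "\<not> ?thesis"
    then have le: "measure M K \<le> measure M A - \<epsilon> / 4" if "K \<subseteq> A" "compact K" for K
      using that by force
    have "measure M A - \<epsilon> / 4 \<ge> 0" using le[of "{}"] by simp
    moreover have "emeasure M A \<le> ennreal (measure M A - \<epsilon> / 4)"
      unfolding inner_regular[OF s fin A]
      by (rule SUP_least) (auto simp: emeasure_eq_measure intro!: ennreal_leI le)
    ultimately show False using \<epsilon> by (simp add: emeasure_eq_measure)
  qed
  then obtain K where K: "K \<subseteq> A" "compact K" "measure M A - \<epsilon> / 4 < measure M K" by blast
  have [measurable]: "K \<in> sets borel" using compact_imp_closed[OF K(2)] by simp
  have AK: "measure M (A - K) < \<epsilon> / 4"
    using K s A by (subst finite_measure_Diff) auto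
  \<comment> \<open>\<open>infdist x {}\<close> is 0, which would make the tent of an empty K
    constantly 1; hence the separate case.\<close>
  define F where "F = (\<lambda>n x. if K = {} then 0 else max 0 (1 - real n * infdist x K))"
  have F1: "\<bar>F n x\<bar> \<le> 1" for n x
    using infdist_nonneg[of x K] mult_nonneg_nonneg[of "real n" "infdist x K"] by (auto simp: F_def)
  have F2: "(real n)-lipschitz_on UNIV (F n)" for n
  proof (rule lipschitz_onI)
    fix x y
    have "\<bar>max 0 (1 - a) - max 0 (1 - b)\<bar> \<le> \<bar>a - b\<bar>" for a b :: real by (auto simp: max_def)
    then have "dist (F n x) (F n y) \<le> \<bar>real n * infdist x K - real n * infdist y K\<bar>"
      by (simp add: F_def dist_real_def)
    also have "\<dots> = real n * \<bar>infdist x K - infdist y K\<bar>" by (simp add: abs_mult flip: right_diff_distrib)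
    also have "\<dots> \<le> real n * dist x y" by (intro mult_left_mono infdist_triangle_abs) simp
    finally show "dist (F n x) (F n y) \<le> real n * dist x y" .
  qed simp
  have [measurable]: "F n \<in> borel_measurable borel" for n
    by (rule borel_measurable_continuous_onI[OF lipschitz_on_continuous_on[OF F2]])
  have "(\<lambda>n. \<integral>x. (F n x - indicator K x)\<^sup>2 \<partial>M) \<longlonglongrightarrow> (\<integral>x. 0 \<partial>M)"
  proof (rule integral_dominated_convergence[where w="\<lambda>x. 4"])
    show "AE x in M. (\<lambda>n. (F n x - indicator K x)\<^sup>2) \<longlonglongrightarrow> 0"
    proof (rule AE_I2)
      fix x
      have "eventually (\<lambda>n. F n x = indicator K x) sequentially"
      proof (cases "x \<in> K")
        case True
        then show ?thesis by (auto simp: F_def)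
      next
        case False
        show ?thesis
        proof (cases "K = {}")
          case False
          then have pos: "0 < infdist x K"
            using \<open>x \<notin> K\<close> compact_imp_closed[OF K(2)] infdist_nonneg[of x K]
            by (metis in_closed_iff_infdist_zero less_le)
          obtain N where N: "1 < real N * infdist x K"
            using reals_Archimedean3[OF pos] by blast
          show ?thesis
          proof (rule eventually_sequentiallyI[of N])
            fix n assume "N \<le> n"
            then have "real N * infdist x K \<le> real n * infdist x K" using pos by simp
            then show "F n x = indicator K x" using N \<open>x \<notin> K\<close> by (simp add: F_def)
          qed
        qed (simp add: F_def)
      qed
      then have "eventually (\<lambda>n. (F n x - indicator K x)\<^sup>2 = 0) sequentially"
        by eventually_elim simp
      then show "(\<lambda>n. (F n x - indicator K x)\<^sup>2) \<longlonglongrightarrow> 0" by (rule tendsto_eventually)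
    qed
    show "AE x in M. norm ((F n x - indicator K x)\<^sup>2) \<le> 4" for n
    proof (rule AE_I2)
      fix x
      have "\<bar>F n x - indicator K x\<bar> \<le> 2" using F1[of n x] by (auto simp: indicator_def)
      then have "\<bar>F n x - indicator K x\<bar>\<^sup>2 \<le> 2\<^sup>2" by (intro power_mono) auto
      then show "norm ((F n x - indicator K x)\<^sup>2) \<le> 4" by simp
    qed
  qed auto
  then have "eventually (\<lambda>n. (\<integral>x. (F n x - indicator K x)\<^sup>2 \<partial>M) < \<epsilon> / 4) sequentially"
    using \<epsilon> by (intro order_tendstoD(2)[where a="\<epsilon> / 4"]) auto
  then obtain n where n: "(\<integral>x. (F n x - indicator K x)\<^sup>2 \<partial>M) < \<epsilon> / 4"
    by (auto simp: eventually_sequentially)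
  have int: "square_integrable M (\<lambda>x. F n x - indicator B x)" if "B \<in> sets borel" for B
    using F1[of n] that by (intro square_integrable_diff square_integrable_bounded[where B=1]) auto
  have int2: "square_integrable M (\<lambda>x. indicator B x :: real)" if "B \<in> sets borel" for B
    using that by (intro square_integrable_bounded[where B=1]) auto
  have "(\<integral>x. (F n x - indicator A x)\<^sup>2 \<partial>M) = (\<integral>x. (norm ((F n x - indicator K x) + (-1) *\<^sub>R indicator (A - K) x))\<^sup>2 \<partial>M)"
    using K(1) by (intro Bochner_Integration.integral_cong refl) (auto simp: indicator_def)
  also have "\<dots> \<le> 2 * (\<integral>x. (norm (F n x - indicator K x))\<^sup>2 \<partial>M) + 2 * (\<integral>x. (norm ((-1) *\<^sub>R (indicator (A - K) x :: real)))\<^sup>2 \<partial>M)"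
    by (intro integral_norm_add_squared_le int square_integrable_scaleR int2) auto
  also have "(\<integral>x. (norm ((-1) *\<^sub>R (indicator (A - K) x :: real)))\<^sup>2 \<partial>M) = (\<integral>x. indicator (A - K) x \<partial>M)"
    by (intro Bochner_Integration.integral_cong refl) (auto simp: indicator_def)
  also have "\<dots> = measure M (A - K)"
    using sets_eq_imp_space_eq[OF s] by simp
  finally have "(\<integral>x. (F n x - indicator A x)\<^sup>2 \<partial>M) < \<epsilon>" using n AK by simp
  then show ?thesis using that[of "F n" "real n"] F1 F2 by blast
qed

text \<open>Induction over the values of \<open>v\<close>, with one Lipschitz cutoff for each level
  set. The tolerance is arbitrary in the induction, because every added term doubles the squared
  errors.\<close>

lemma bounded_Lipschitz_approx:
  fixes M :: "'a::euclidean_space measure" and v :: "'a \<Rightarrow> 'b::euclidean_space"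
  assumes M: "finite_measure M" and s: "sets M = sets borel" and v: "simple_function M v" and \<epsilon>: "0 < \<epsilon>"
  obtains w B C where "\<And>x. norm (w x) \<le> B" "C-lipschitz_on UNIV w"
    "(\<integral>x. (norm (w x - v x))\<^sup>2 \<partial>M) \<le> \<epsilon>\<^sup>2"
proof -
  interpret finite_measure M by fact
  have sp: "space M = UNIV" using sets_eq_imp_space_eq[OF s] by simp
  have fr: "finite (range v)" using v sp by (simp add: simple_function_def)
  have A: "v -` {y} \<in> sets borel" for y
    using cell_sets[OF v, of y] sp s by (simp add: vimage_def)
  have meas: "g \<in> borel_measurable M" if "C-lipschitz_on UNIV g" for C and g :: "'a \<Rightarrow> 'c::euclidean_space"
    using borel_measurable_continuous_onI[OF lipschitz_on_continuous_on[OF that]] s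
    by (simp cong: measurable_cong_sets)
  have "\<exists>w B C. (\<forall>x. norm (w x) \<le> B) \<and> C-lipschitz_on UNIV w \<and>
      (\<integral>x. (norm (w x - (\<Sum>y\<in>Y. indicator (v -` {y}) x *\<^sub>R y)))\<^sup>2 \<partial>M) < \<delta>" if "finite Y" "0 < \<delta>" for Y \<delta>
    using that
  proof (induction Y arbitrary: \<delta>)
    case empty
    show ?case
      by (rule exI[of _ "\<lambda>_. 0"], rule exI[of _ 0], rule exI[of _ 0])
        (use empty in \<open>auto intro: lipschitz_on_constant\<close>)
  next
    case (insert y Y)
    \<comment> \<open>Chosen so that |y|^2 \<eta> \<le> \<delta>/4; the summand 1 covers y =
      0.\<close>
    define \<eta> where "\<eta> = \<delta> / (4 * ((norm y)\<^sup>2 + 1))"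
    have pos: "0 < (norm y)\<^sup>2 + 1" by (simp add: add_nonneg_pos)
    have \<eta>: "0 < \<eta>" using insert.prems pos by (simp add: \<eta>_def)
    obtain w B C where w: "\<And>x. norm (w x) \<le> B" "C-lipschitz_on UNIV w"
      "(\<integral>x. (norm (w x - (\<Sum>y\<in>Y. indicator (v -` {y}) x *\<^sub>R y)))\<^sup>2 \<partial>M) < \<delta> / 4"
      using insert.IH[of "\<delta> / 4"] insert.prems by auto
    obtain f C' where f: "\<And>x. \<bar>f x\<bar> \<le> 1" "C'-lipschitz_on UNIV f"
      "(\<integral>x. (f x - indicator (v -` {y}) x)\<^sup>2 \<partial>M) < \<eta>"
      by (rule Lipschitz_indicator_approx[OF M s A \<eta>]) blast
    have fl: "(C' * norm y)-lipschitz_on UNIV (\<lambda>x. f x *\<^sub>R y)"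
    proof (rule lipschitz_onI)
      fix x x'
      have "dist (f x *\<^sub>R y) (f x' *\<^sub>R y) = dist (f x) (f x') * norm y"
        by (simp add: dist_norm flip: scaleR_diff_left)
      also have "\<dots> \<le> C' * dist x x' * norm y"
        by (intro mult_right_mono lipschitz_onD[OF f(2)]) auto
      finally show "dist (f x *\<^sub>R y) (f x' *\<^sub>R y) \<le> C' * norm y * dist x x'" by (simp add: mult_ac)
    qed (use lipschitz_on_nonneg[OF f(2)] in simp)
    have fb: "norm (f x *\<^sub>R y) \<le> norm y" for x
      using f(1)[of x] mult_right_mono[of "\<bar>f x\<bar>" 1 "norm y"] by simp
    let ?g = "\<lambda>x. \<Sum>y\<in>Y. indicator (v -` {y}) x *\<^sub>R y"
    have gs: "square_integrable M ?g"
    proof (rule square_integrable_bounded[where B="\<Sum>y\<in>Y. norm y"])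
      show "?g \<in> borel_measurable M" using A s by (intro borel_measurable_sum) auto
      show "norm (?g x) \<le> (\<Sum>y\<in>Y. norm y)" for x
        by (intro order_trans[OF norm_sum] sum_mono) (auto simp: indicator_def)
    qed
    have ws: "square_integrable M w" by (rule square_integrable_bounded[OF meas[OF w(2)] w(1)])
    have fs: "square_integrable M (\<lambda>x. f x *\<^sub>R y - indicator (v -` {y}) x *\<^sub>R y)"
    proof (intro square_integrable_diff)
      show "square_integrable M (\<lambda>x. f x *\<^sub>R y)" by (rule square_integrable_bounded[OF meas[OF fl] fb])
      show "square_integrable M (\<lambda>x. indicator (v -` {y}) x *\<^sub>R y)"
      proof (rule square_integrable_bounded[where B="norm y"])
        show "(\<lambda>x. indicator (v -` {y}) x *\<^sub>R y) \<in> borel_measurable M"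
          using A[of y] s by (intro borel_measurable_scaleR borel_measurable_indicator) auto
      qed (auto simp: indicator_def)
    qed
    have "(\<integral>x. (norm (f x *\<^sub>R y - indicator (v -` {y}) x *\<^sub>R y))\<^sup>2 \<partial>M) = (norm y)\<^sup>2 * (\<integral>x. (f x - indicator (v -` {y}) x)\<^sup>2 \<partial>M)"
      by (simp add: power_mult_distrib mult.commute flip: scaleR_diff_left)
    also have "\<dots> \<le> (norm y)\<^sup>2 * \<eta>" using f(3) by (intro mult_left_mono) auto
    also have "\<dots> \<le> ((norm y)\<^sup>2 + 1) * \<eta>" using \<eta> by simp
    also have "((norm y)\<^sup>2 + 1) * \<eta> = \<delta> / 4"
    proof -
      have "N * (\<delta> / (4 * N)) = \<delta> / 4" if "0 < N" for N :: real using that by simp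
      from this[OF pos] show ?thesis by (simp only: \<eta>_def)
    qed
    finally have 1: "(\<integral>x. (norm (f x *\<^sub>R y - indicator (v -` {y}) x *\<^sub>R y))\<^sup>2 \<partial>M) \<le> \<delta> / 4" .
    have "(\<integral>x. (norm ((w x + f x *\<^sub>R y) - (\<Sum>y\<in>insert y Y. indicator (v -` {y}) x *\<^sub>R y)))\<^sup>2 \<partial>M)
        = (\<integral>x. (norm ((w x - ?g x) + (f x *\<^sub>R y - indicator (v -` {y}) x *\<^sub>R y)))\<^sup>2 \<partial>M)"
      unfolding sum.insert[OF insert.hyps] by (simp only: algebra_simps)
    also have "\<dots> \<le> 2 * (\<integral>x. (norm (w x - ?g x))\<^sup>2 \<partial>M) + 2 * (\<integral>x. (norm (f x *\<^sub>R y - indicator (v -` {y}) x *\<^sub>R y))\<^sup>2 \<partial>M)"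
      by (intro integral_norm_add_squared_le square_integrable_diff ws gs fs)
    also have "\<dots> < \<delta>" using 1 w(3) by linarith
    finally have 2: "(\<integral>x. (norm ((w x + f x *\<^sub>R y) - (\<Sum>y\<in>insert y Y. indicator (v -` {y}) x *\<^sub>R y)))\<^sup>2 \<partial>M) < \<delta>" .
    have "norm (w x + f x *\<^sub>R y) \<le> B + norm y" for x
      using norm_triangle_mono[OF w(1)[of x] fb[of x]] .
    with 2 lipschitz_on_add[OF w(2) fl] show ?case
      by (intro exI[of _ "\<lambda>x. w x + f x *\<^sub>R y"] exI[of _ "B + norm y"] exI[of _ "C + C' * norm y"] conjI allI)
  qed
  from this[OF fr, of "\<epsilon>\<^sup>2"] \<epsilon> obtain w B C where w: "\<And>x. norm (w x) \<le> B" "C-lipschitz_on UNIV w"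
      "(\<integral>x. (norm (w x - (\<Sum>y\<in>range v. indicator (v -` {y}) x *\<^sub>R y)))\<^sup>2 \<partial>M) < \<epsilon>\<^sup>2"
    by auto
  have "(\<Sum>y\<in>range v. indicator (v -` {y}) x *\<^sub>R y) = v x" for x
  proof -
    have "(\<Sum>y\<in>range v. indicator (v -` {y}) x *\<^sub>R y) = (\<Sum>y\<in>{v x}. indicator (v -` {y}) x *\<^sub>R y)"
      by (rule sum.mono_neutral_right[OF fr]) (auto simp: indicator_def)
    then show ?thesis by simp
  qed
  then show ?thesis using that[OF w(1,2)] w(3) by simp
qed

subsection \<open>Subgradients along couplings\<close>

context convex_Lipschitz_functional
begin

text \<open>The term 2 L comes from a distance of at most 2 \<epsilon> between the averaged
  interpolant and the translate of \<mu>. The bracket collects three uses of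
  \<open>integral_inner_le\<close>, which contribute 1 + \<open>?A\<close> twice and 1 +
  \<open>?B\<close> once.\<close>

lemma subgradient_approx:
  assumes \<Xi>: "\<Xi> \<in> clarke_subdiff G \<mu>" and \<nu>: "\<nu> \<in> P2" and \<gamma>: "\<gamma> \<in> couplings \<mu> \<nu>"
    and \<epsilon>: "0 < \<epsilon>" "\<epsilon> \<le> r / 8" and T: "0 < T" "T \<le> 1"
    and near: "16 * (T\<^sup>2 * (\<integral>p. (norm (snd p - fst p))\<^sup>2 \<partial>\<gamma>)) \<le> r\<^sup>2"
    and a: "G \<mu> = ereal a" and n: "G \<nu> = ereal n"
  shows "T * (\<integral>p. \<Xi> (fst p) \<bullet> (snd p - fst p) \<partial>\<gamma>) \<le> T * (n - a) + \<epsilon> * (2 * L +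
    T * (3 + 2 * (\<integral>p. (norm (snd p - fst p))\<^sup>2 \<partial>\<gamma>) + (\<integral>p. (norm (\<Xi> (fst p)))\<^sup>2 \<partial>\<gamma>)))"
    (is "T * ?I \<le> T * (n - a) + \<epsilon> * (2 * L + T * (3 + 2 * ?A + ?B))")
proof -
  note cf = couplings_marginals[OF \<gamma> \<mu> \<nu>]
  interpret \<mu>: prob_space \<mu> using \<mu> by (simp add: P2_def)
  interpret prob_space \<gamma> by (rule cf)
  have s\<mu>: "sets \<mu> = sets borel" using \<mu> by (simp add: P2_def)
  have \<mu>_eq: "distr \<gamma> borel fst = \<mu>" and \<nu>_eq: "distr \<gamma> borel snd = \<nu>" using \<gamma> by (auto simp: couplings_def)
  have fst_m: "fst \<in> borel_measurable \<gamma>" using cf(7) by (simp add: square_integrable_def)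
  have int\<mu>: "(\<integral>x. f x \<partial>\<mu>) = (\<integral>p. f (fst p) \<partial>\<gamma>)" if "f \<in> borel_measurable borel" for f :: "'a \<Rightarrow> real"
    using integral_distr[OF fst_m that] \<mu>_eq by simp
  have \<Xi>2: "square_integrable \<mu> \<Xi>" using \<Xi> by (simp add: clarke_subdiff_def L2_iff_square_integrable)
  have \<Xi>m: "\<Xi> \<in> borel_measurable borel"
    using \<Xi>2 s\<mu> by (simp add: square_integrable_def cong: measurable_cong_sets)
  have \<Xi>\<gamma>: "square_integrable \<gamma> (\<lambda>p. \<Xi> (fst p))" using cf(5)[OF \<Xi>m] \<Xi>2 by simp
  have id_m: "(\<lambda>x. x) \<in> borel_measurable \<mu>" using s\<mu> by (simp cong: measurable_cong_sets)
  \<comment> \<open>Approximating the pair by one simple map makes a single partition serve both x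
    and \<Xi> x.\<close>
  have pair2: "square_integrable \<mu> (\<lambda>x. (x, \<Xi> x))"
  proof (rule square_integrable_bound[where g="\<lambda>x. (norm x)\<^sup>2 + (norm (\<Xi> x))\<^sup>2"])
    show "(\<lambda>x. (x, \<Xi> x)) \<in> borel_measurable \<mu>"
      by (rule measurable_Pair_borel[OF id_m]) (use \<Xi>2 in \<open>simp add: square_integrable_def\<close>)
    show "integrable \<mu> (\<lambda>x. (norm x)\<^sup>2 + (norm (\<Xi> x))\<^sup>2)"
      using \<Xi>2 \<mu> by (simp add: square_integrable_def P2_def)
  qed (simp add: norm_Pair)
  obtain s where s: "simple_function \<mu> s" and sle: "(\<integral>x. (norm ((x, \<Xi> x) - s x))\<^sup>2 \<partial>\<mu>) \<le> \<epsilon>\<^sup>2"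
    by (rule square_integrable_simple_approx[OF pair2 \<epsilon>(1)])
  have sm: "s \<in> borel_measurable borel"
    using borel_measurable_simple_function[OF s] s\<mu> by (simp cong: measurable_cong_sets)
  let ?X = "\<lambda>p. fst p :: 'a" and ?D = "\<lambda>p. snd p - fst p :: 'a"
  \<comment> \<open>Cells depend on the first coordinate only, so a function of the label is a
    function of x and can be approximated by a map \<open>w\<close>.\<close>
  define S where "S = (\<lambda>p :: 'a \<times> 'a. s (fst p))"
  have S: "simple_function \<gamma> S"
    unfolding S_def
    by (rule simple_function_comp[OF _ s]) (use fst_m s\<mu> in \<open>simp cong: measurable_cong_sets\<close>)
  have Sh: "square_integrable \<gamma> (\<lambda>p. h (S p))" for h :: "'a \<times> 'a \<Rightarrow> 'a"
    by (rule square_integrable_cells[OF prob_space_axioms S])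
  have X2: "square_integrable \<gamma> ?X" and D2: "square_integrable \<gamma> ?D"
    using cf(7,8) square_integrable_diff by auto
  define v where "v = cell_mean \<gamma> S ?D"
  define m where "m = cell_mean \<gamma> S ?X"
  have "simple_function \<mu> (\<lambda>x. v (s x))"
    using simple_function_compose[OF s, of v] by (simp add: comp_def)
  then obtain w B C where B: "\<And>x. norm (w x) \<le> B" and C: "C-lipschitz_on UNIV w"
      and wle: "(\<integral>x. (norm (w x - v (s x)))\<^sup>2 \<partial>\<mu>) \<le> \<epsilon>\<^sup>2"
    using bounded_Lipschitz_approx[OF \<mu>.finite_measure_axioms s\<mu> _ \<epsilon>(1)] by metis
  have cont: "continuous_on UNIV w" by (rule lipschitz_on_continuous_on[OF C])
  have w1: "w \<in> C1" by (rule bounded_continuous_in_C1[OF cont B])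
  have wm: "w \<in> borel_measurable borel" by (rule borel_measurable_continuous_onI[OF cont])
  have vsm: "(\<lambda>x. v (s x)) \<in> borel_measurable borel"
    using borel_measurable_simple_function[OF \<open>simple_function \<mu> (\<lambda>x. v (s x))\<close>] s\<mu>
    by (simp cong: measurable_cong_sets)
  let ?W = "\<lambda>p :: 'a \<times> 'a. w (fst p)"
  have W2: "square_integrable \<gamma> ?W" using cf(5)[OF wm] square_integrable_C1[OF w1 \<mu>] by simp
  have split: "(norm ((x, y) - z))\<^sup>2 = (norm (x - fst z))\<^sup>2 + (norm (y - snd z))\<^sup>2" for x y :: 'a and z
    by (cases z) (simp add: norm_Pair)
  have "(\<integral>p. (norm ((?X p, \<Xi> (fst p)) - S p))\<^sup>2 \<partial>\<gamma>) \<le> \<epsilon>\<^sup>2"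
    using sle \<Xi>m sm measurable_Pair_borel[of "\<lambda>x. x" borel \<Xi>] by (subst (asm) int\<mu>) (auto simp: S_def)
  then have "(\<integral>p. (norm (?X p - fst (S p)))\<^sup>2 \<partial>\<gamma>) + (\<integral>p. (norm (\<Xi> (fst p) - snd (S p)))\<^sup>2 \<partial>\<gamma>) \<le> \<epsilon>\<^sup>2"
    using square_integrable_diff[OF X2 Sh[of fst]] square_integrable_diff[OF \<Xi>\<gamma> Sh[of snd]]
    by (simp add: split square_integrable_def)
  moreover have "0 \<le> (\<integral>p. (norm (?X p - fst (S p)))\<^sup>2 \<partial>\<gamma>)" "0 \<le> (\<integral>p. (norm (\<Xi> (fst p) - snd (S p)))\<^sup>2 \<partial>\<gamma>)"
    by simp_all
  ultimately have f0: "(\<integral>p. (norm (?X p - fst (S p)))\<^sup>2 \<partial>\<gamma>) \<le> \<epsilon>\<^sup>2"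
    and f4: "(\<integral>p. (norm (\<Xi> (fst p) - snd (S p)))\<^sup>2 \<partial>\<gamma>) \<le> \<epsilon>\<^sup>2" by linarith+
  \<comment> \<open>\<open>fst (S p)\<close> is one cellwise constant approximation of x, and the
    cell mean is at least as good.\<close>
  have f1: "(\<integral>p. (norm (?X p - m (S p)))\<^sup>2 \<partial>\<gamma>) \<le> \<epsilon>\<^sup>2"
    unfolding m_def using integral_norm_cell_mean_le(2)[OF S X2, of fst] f0 by linarith
  have f2: "(\<integral>p. (norm (v (S p)))\<^sup>2 \<partial>\<gamma>) \<le> ?A"
    unfolding v_def by (rule integral_norm_cell_mean_le(1)[OF S D2])
  have f3: "(\<integral>p. (norm (?W p - v (S p)))\<^sup>2 \<partial>\<gamma>) \<le> \<epsilon>\<^sup>2"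
    using wle wm vsm by (subst (asm) int\<mu>) (auto simp: S_def)
  have f5: "(\<integral>p. snd (S p) \<bullet> v (S p) \<partial>\<gamma>) = (\<integral>p. snd (S p) \<bullet> ?D p \<partial>\<gamma>)"
    unfolding v_def by (rule integral_inner_cell_mean[OF S D2])

  \<comment> \<open>With \<xi> = \<open>snd (S p)\<close>, the pairing splits as (\<Xi> - \<xi>)
    \<bullet> D + \<xi> \<bullet> D. By \<open>f5\<close>, \<xi> \<bullet> D has the same integral
    as \<xi> \<bullet> v = (\<xi> - \<Xi>) \<bullet> v + (v - w) \<bullet> \<Xi> + \<Xi> \<bullet>
    w.\<close>
  have I: "?I \<le> \<epsilon> * (3 + 2 * ?A + ?B) + inner_L2 \<mu> \<Xi> w"
  proof -
    have J: "inner_L2 \<mu> \<Xi> w = (\<integral>p. \<Xi> (fst p) \<bullet> ?W p \<partial>\<gamma>)"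
      unfolding inner_L2_def using \<Xi>m wm by (intro int\<mu>) auto
    have f4': "(\<integral>p. (norm (snd (S p) - \<Xi> (fst p)))\<^sup>2 \<partial>\<gamma>) \<le> \<epsilon>\<^sup>2"
      and f3': "(\<integral>p. (norm (v (S p) - ?W p))\<^sup>2 \<partial>\<gamma>) \<le> \<epsilon>\<^sup>2"
      using f4 f3 by (simp_all add: norm_minus_commute)
    note si = \<Xi>\<gamma> D2 W2 Sh[of v] Sh[of snd]
    have "?I = (\<integral>p. (\<Xi> (fst p) - snd (S p)) \<bullet> ?D p \<partial>\<gamma>) + (\<integral>p. snd (S p) \<bullet> v (S p) \<partial>\<gamma>)"
      using square_integrable_inner[OF si(1,2)] square_integrable_inner[OF si(5,2)]
      by (simp add: f5 inner_diff_left)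
    also have "(\<integral>p. snd (S p) \<bullet> v (S p) \<partial>\<gamma>) = (\<integral>p. (snd (S p) - \<Xi> (fst p)) \<bullet> v (S p) \<partial>\<gamma>)
        + (\<integral>p. (v (S p) - ?W p) \<bullet> \<Xi> (fst p) \<partial>\<gamma>) + (\<integral>p. \<Xi> (fst p) \<bullet> ?W p \<partial>\<gamma>)"
      using square_integrable_inner[OF si(5,4)] square_integrable_inner[OF si(1,4)]
        square_integrable_inner[OF si(4,1)] square_integrable_inner[OF si(3,1)]
      by (simp add: inner_diff_left inner_diff_right inner_commute)
    also have "(\<integral>p. (\<Xi> (fst p) - snd (S p)) \<bullet> ?D p \<partial>\<gamma>) \<le> \<epsilon> * (1 + ?A)"
      by (rule integral_inner_le[OF square_integrable_diff[OF si(1,5)] si(2) f4 \<epsilon>(1)])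
    also have "(\<integral>p. (snd (S p) - \<Xi> (fst p)) \<bullet> v (S p) \<partial>\<gamma>) \<le> \<epsilon> * (1 + ?A)"
      by (rule order_trans[OF integral_inner_le[OF square_integrable_diff[OF si(5,1)] si(4) f4' \<epsilon>(1)]])
        (use f2 \<epsilon> in simp)
    also have "(\<integral>p. (v (S p) - ?W p) \<bullet> \<Xi> (fst p) \<partial>\<gamma>) \<le> \<epsilon> * (1 + ?B)"
      by (rule integral_inner_le[OF square_integrable_diff[OF si(4,3)] si(1) f3' \<epsilon>(1)])
    finally show ?thesis using J by (simp add: algebra_simps)
  qed

  define Z where "Z = (\<lambda>p :: 'a \<times> 'a. (1 - T) *\<^sub>R fst p + T *\<^sub>R snd p)"
  have Z2: "square_integrable \<gamma> Z"
    unfolding Z_def by (intro square_integrable_add square_integrable_scaleR cf(7,8))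
  have cZ: "cell_mean \<gamma> S Z i = m i + T *\<^sub>R v i" for i
  proof -
    interpret K: prob_space "cell_law \<gamma> S i" by (rule prob_space_cell_law)
    have "integrable (cell_law \<gamma> S i) ?X" "integrable (cell_law \<gamma> S i) ?D"
      by (rule K.square_integrable_imp_integrable square_integrable_cell_law[OF S] X2 D2)+
    moreover have "Z = (\<lambda>p. ?X p + T *\<^sub>R ?D p)" by (auto simp: Z_def algebra_simps)
    ultimately show ?thesis by (simp add: cell_mean_def m_def v_def)
  qed
  let ?c = "\<lambda>p. m (S p) + T *\<^sub>R v (S p)"
  have e2: "64 * \<epsilon>\<^sup>2 \<le> r\<^sup>2" using power_mono[OF \<epsilon>(2), of 2] \<epsilon>(1) by (simp add: power_divide)
  have r2: "0 < r\<^sup>2" using r by simp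
  have T2: "T\<^sup>2 \<le> 1" using T by (simp add: power_le_one)
  have Tle: "(\<integral>p. (norm (T *\<^sub>R f p))\<^sup>2 \<partial>\<gamma>) = T\<^sup>2 * (\<integral>p. (norm (f p))\<^sup>2 \<partial>\<gamma>)" for f :: "'a \<times> 'a \<Rightarrow> 'a"
    by (simp add: power_mult_distrib)
  have TA: "T\<^sup>2 * (\<integral>p. (norm (v (S p)))\<^sup>2 \<partial>\<gamma>) \<le> T\<^sup>2 * ?A"
    using f2 by (rule mult_left_mono) simp
  have Te: "T\<^sup>2 * (\<integral>p. (norm (?W p - v (S p)))\<^sup>2 \<partial>\<gamma>) \<le> \<epsilon>\<^sup>2"
    using mult_mono[OF T2 f3] by simp
  \<comment> \<open>The left side is at most 4 \<epsilon>^2 + 4 T^2 \<open>?A\<close> \<le> r^2/16 +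
    r^2/4, by \<epsilon> \<le> r/8 and \<open>near\<close>.\<close>
  have n1: "2 * (\<integral>p. (norm (?X p - ?c p))\<^sup>2 \<partial>\<gamma>) < r\<^sup>2"
  proof -
    have "(\<integral>p. (norm (?X p - ?c p))\<^sup>2 \<partial>\<gamma>) = (\<integral>p. (norm ((?X p - m (S p)) + (-1) *\<^sub>R (T *\<^sub>R v (S p))))\<^sup>2 \<partial>\<gamma>)"
      by (simp add: algebra_simps)
    also have "\<dots> \<le> 2 * (\<integral>p. (norm (?X p - m (S p)))\<^sup>2 \<partial>\<gamma>) + 2 * (\<integral>p. (norm ((-1) *\<^sub>R (T *\<^sub>R v (S p))))\<^sup>2 \<partial>\<gamma>)"
      by (intro integral_norm_add_squared_le square_integrable_diff square_integrable_scaleR X2 Sh)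
    also have "(\<integral>p. (norm ((-1) *\<^sub>R (T *\<^sub>R v (S p))))\<^sup>2 \<partial>\<gamma>) = T\<^sup>2 * (\<integral>p. (norm (v (S p)))\<^sup>2 \<partial>\<gamma>)"
      using Tle[of "\<lambda>p. v (S p)"] by simp
    finally show ?thesis using f1 TA near e2 r2 by linarith
  qed
  have c2: "square_integrable \<gamma> ?c"
    by (intro square_integrable_add square_integrable_scaleR Sh)
  have averaged: "G (distr \<gamma> borel ?c) \<le> G (distr \<gamma> borel Z)"
    using cell_mean_le[OF prob_space_axioms S Z2 X2 \<mu>_eq] n1 by (simp add: cZ)
  have convex: "G (distr \<gamma> borel Z) \<le> ereal ((1 - T) * a + T * n)"
    using convex_along_plans_distr[OF conv prob_space_axioms cf(7,8), of T] T a n \<mu>_eq \<nu>_eq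
    by (simp add: Z_def)
  let ?g = "\<lambda>x. x + T *\<^sub>R w x"
  have gm: "?g \<in> borel_measurable borel" using wm by simp
  have g_eq: "distr \<mu> borel ?g = distr \<gamma> borel (\<lambda>p. ?g (fst p))" using cf(3)[OF gm] by simp
  have g2: "square_integrable \<gamma> (\<lambda>p. ?g (fst p))"
    using cf(5)[OF gm] translate_in_P2(1)[OF w1 \<mu>] by simp
  have n2: "W2 \<mu> (distr \<mu> borel ?g) < r"
  proof -
    have "(\<integral>p. (norm (?X p - ?g (fst p)))\<^sup>2 \<partial>\<gamma>) = T\<^sup>2 * (\<integral>p. (norm ((?W p - v (S p)) + v (S p)))\<^sup>2 \<partial>\<gamma>)"
      using Tle[of ?W] by simp
    also have "\<dots> \<le> T\<^sup>2 * (2 * (\<integral>p. (norm (?W p - v (S p)))\<^sup>2 \<partial>\<gamma>) + 2 * (\<integral>p. (norm (v (S p)))\<^sup>2 \<partial>\<gamma>))"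
      by (intro mult_left_mono integral_norm_add_squared_le square_integrable_diff W2 Sh) simp
    also have "\<dots> = 2 * (T\<^sup>2 * (\<integral>p. (norm (?W p - v (S p)))\<^sup>2 \<partial>\<gamma>)) + 2 * (T\<^sup>2 * (\<integral>p. (norm (v (S p)))\<^sup>2 \<partial>\<gamma>))"
      by (simp add: algebra_simps)
    also have "\<dots> \<le> r\<^sup>2 / 4" using Te TA near e2 r2 by linarith
    also have "r\<^sup>2 / 4 = (r / 2)\<^sup>2" by (simp add: power_divide)
    finally have "W2 (distr \<gamma> borel fst) (distr \<gamma> borel (\<lambda>p. ?g (fst p))) \<le> r / 2"
      using r fst_m g2 by (intro W2_distr_le[OF prob_space_axioms]) (auto simp: square_integrable_def)
    then show ?thesis using r \<mu>_eq g_eq by simp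
  qed
  have n3: "W2 \<mu> (distr \<gamma> borel ?c) < r"
  proof -
    have "W2 (distr \<gamma> borel fst) (distr \<gamma> borel ?c) \<le> sqrt (\<integral>p. (norm (?X p - ?c p))\<^sup>2 \<partial>\<gamma>)"
      using fst_m c2 by (intro W2_distr_le[OF prob_space_axioms]) (auto simp: square_integrable_def)
    also have "\<dots> < r"
    proof (rule real_less_lsqrt)
      have "0 \<le> (\<integral>p. (norm (?X p - ?c p))\<^sup>2 \<partial>\<gamma>)" by simp
      then show "(\<integral>p. (norm (?X p - ?c p))\<^sup>2 \<partial>\<gamma>) < r\<^sup>2" using n1 by linarith
    qed (use r in simp)
    finally show ?thesis using \<mu>_eq by simp
  qed
  \<comment> \<open>The position error and, as T \<le> 1, the displacement error are each at most
    \<epsilon>^2, and 2 \<epsilon>^2 + 2 \<epsilon>^2 = (2 \<epsilon>)^2.\<close>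
  have n4: "W2 (distr \<mu> borel ?g) (distr \<gamma> borel ?c) \<le> 2 * \<epsilon>"
  proof -
    have "(\<integral>p. (norm (?g (fst p) - ?c p))\<^sup>2 \<partial>\<gamma>)
        = (\<integral>p. (norm ((?X p - m (S p)) + T *\<^sub>R (?W p - v (S p))))\<^sup>2 \<partial>\<gamma>)"
      by (simp add: algebra_simps)
    also have "\<dots> \<le> 2 * (\<integral>p. (norm (?X p - m (S p)))\<^sup>2 \<partial>\<gamma>) + 2 * (\<integral>p. (norm (T *\<^sub>R (?W p - v (S p))))\<^sup>2 \<partial>\<gamma>)"
      by (intro integral_norm_add_squared_le square_integrable_diff square_integrable_scaleR X2 Sh W2)
    also have "\<dots> \<le> (2 * \<epsilon>)\<^sup>2" using f1 Te Tle[of "\<lambda>p. ?W p - v (S p)"] by simp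
    finally show ?thesis
      unfolding g_eq using \<epsilon> g2 c2
      by (intro W2_distr_le[OF prob_space_axioms]) (auto simp: square_integrable_def)
  qed
  have "ereal (a + T * inner_L2 \<mu> \<Xi> w) \<le> G (distr \<mu> borel ?g)"
    using clarke_subdiff_imp_translate_le[OF \<Xi> B C T(1)] a by simp
  also have "\<dots> \<le> G (distr \<gamma> borel ?c) + ereal (L * (2 * \<epsilon>))"
    by (rule Lipschitz_le(1)[OF translate_in_P2(2)[OF w1 \<mu>] distr_in_P2[OF prob_space_axioms c2] n2 n3 n4])
  also have "\<dots> \<le> ereal ((1 - T) * a + T * n) + ereal (L * (2 * \<epsilon>))"
    by (intro add_right_mono order_trans[OF averaged convex])
  finally have "T * inner_L2 \<mu> \<Xi> w \<le> T * (n - a) + 2 * L * \<epsilon>"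
    by (simp add: algebra_simps)
  moreover have "T * ?I \<le> T * (\<epsilon> * (3 + 2 * ?A + ?B) + inner_L2 \<mu> \<Xi> w)"
    using I T by (intro mult_left_mono) auto
  ultimately show ?thesis by (simp add: algebra_simps)
qed

lemma clarke_subdiff_imp_subgradient:
  assumes \<Xi>: "\<Xi> \<in> clarke_subdiff G \<mu>" and \<nu>: "\<nu> \<in> P2" and \<gamma>: "\<gamma> \<in> couplings \<mu> \<nu>"
  shows "G \<mu> + ereal (\<integral>p. \<Xi> (fst p) \<bullet> (snd p - fst p) \<partial>\<gamma>) \<le> G \<nu>"
    (is "_ + ereal ?I \<le> _")
proof (cases "G \<nu>")
  case (real n)
  obtain a where a: "G \<mu> = ereal a" by (rule finite_at)
  define A where "A = (\<integral>p. (norm (snd p - fst p))\<^sup>2 \<partial>\<gamma>)"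
  define B where "B = (\<integral>p. (norm (\<Xi> (fst p)))\<^sup>2 \<partial>\<gamma>)"
  have AB: "0 \<le> A" "0 \<le> B" by (auto simp: A_def B_def)
  \<comment> \<open>From (A + 1)^2 \<ge> A one gets 16 T^2 A \<le> r^2 without a square root, and
    the denominator is positive even for A = 0.\<close>
  define T where "T = min 1 (r / (4 * (A + 1)))"
  have T: "0 < T" "T \<le> 1" using r AB by (auto simp: T_def)
  have "(4 * (A + 1) * T)\<^sup>2 \<le> r\<^sup>2"
  proof (rule power_mono)
    have "T \<le> r / (4 * (A + 1))" by (simp add: T_def)
    then show "4 * (A + 1) * T \<le> r" using AB by (simp add: pos_le_divide_eq mult.commute)
  qed (use AB T in simp)
  moreover have "16 * (T\<^sup>2 * A) \<le> 16 * (T\<^sup>2 * (A + 1)\<^sup>2)"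
  proof (intro mult_left_mono)
    have "(A + 1)\<^sup>2 = A + (A * A + A + 1)" by (simp add: power2_eq_square algebra_simps)
    then show "A \<le> (A + 1)\<^sup>2" using AB mult_nonneg_nonneg[of A A] by linarith
  qed auto
  moreover have "(4 * (A + 1) * T)\<^sup>2 = 16 * (T\<^sup>2 * (A + 1)\<^sup>2)" by (simp add: power2_eq_square algebra_simps)
  ultimately have near: "16 * (T\<^sup>2 * A) \<le> r\<^sup>2" by linarith
  define K where "K = 2 * L + T * (3 + 2 * A + B)"
  have K: "0 \<le> K" using L T AB by (simp add: K_def)
  \<comment> \<open>Neither \<open>T\<close> nor \<open>K\<close> depends on \<epsilon>, so the
    error \<epsilon> * K can be made arbitrarily small.\<close>
  have "T * ?I \<le> T * (n - a)"
  proof (rule field_le_epsilon)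
    fix \<eta> :: real assume \<eta>: "0 < \<eta>"
    define \<epsilon> where "\<epsilon> = min (r / 8) (\<eta> / (K + 1))"
    have \<epsilon>: "0 < \<epsilon>" "\<epsilon> \<le> \<eta> / (K + 1)" using r \<eta> K by (auto simp: \<epsilon>_def)
    have "\<epsilon> * K \<le> \<eta> / (K + 1) * (K + 1)"
      using K \<epsilon> by (intro mult_mono) auto
    then have "\<epsilon> * K \<le> \<eta>" using K by simp
    moreover have "T * ?I \<le> T * (n - a) + \<epsilon> * K"
      unfolding K_def A_def B_def
      by (rule subgradient_approx[OF \<Xi> \<nu> \<gamma> \<epsilon>(1) _ T near[unfolded A_def] a real])
        (unfold \<epsilon>_def, rule min.cobounded1)
    ultimately show "T * ?I \<le> T * (n - a) + \<eta>" by linarith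
  qed
  then show ?thesis using T a real by simp
qed (use not_MInf[OF \<nu>] in auto)

end

theorem theorem4p10:
  fixes G :: "'a::euclidean_space measure \<Rightarrow> ereal"
    and \<mu> :: "'a measure"
    and \<Xi> :: "'a \<Rightarrow> 'a"
  assumes "\<And>\<nu>. \<nu> \<in> P2 \<Longrightarrow> G \<nu> \<noteq> -\<infinity>"
    and "convex_along_plans G"
    and "\<mu> \<in> P2"
    and "locally_Lipschitz_around G \<mu>"
    and "\<Xi> \<in> L2 \<mu>"
  shows "\<Xi> \<in> clarke_subdiff G \<mu> \<longleftrightarrow>
    (\<forall>\<nu>\<in>P2. \<forall>\<gamma>\<in>couplings \<mu> \<nu>.
       G \<mu> + ereal (\<integral>p. \<Xi> (fst p) \<bullet> (snd p - fst p) \<partial>\<gamma>) \<le> G \<nu>)"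
proof -
  obtain r L where "0 < r" "0 \<le> L" "\<forall>\<nu>\<in>P2. W2 \<mu> \<nu> < r \<longrightarrow> \<bar>G \<nu>\<bar> \<noteq> \<infinity>"
    "\<forall>\<nu>\<in>P2. \<forall>\<nu>'\<in>P2. W2 \<mu> \<nu> < r \<longrightarrow> W2 \<mu> \<nu>' < r \<longrightarrow> \<bar>G \<nu> - G \<nu>'\<bar> \<le> ereal (L * W2 \<nu> \<nu>')"
    using assms(4) unfolding locally_Lipschitz_around_def by blast
  then interpret convex_Lipschitz_functional G \<mu> r L
    using assms(1-3) by unfold_locales auto
  show ?thesis
    using clarke_subdiff_imp_subgradient subgradient_imp_clarke_subdiff[OF assms(5)] by blast
qed

end
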